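(* Let $k_1,k_2,k_3,k_4\in\mathbb{Z}$ and let $a_1,a_2,a_3,a_4>0$ be such that $a_i=|k_i|$ for $i=1,\ldots,4$. Let $(Q^5,g)$ be the Riemannian manifold $Q^5=\mathbb{S}^1\times\mathbb{S}^1\times\mathbb{S}^1\times\mathbb{S}^1\times(0,\pi/4)$ with the metric $$g=a_1^2\sin^2 s\,d\theta_1^2+a_2^2\sin^2(s+\tfrac{\pi}{4})\,d\theta_2^2+a_3^2\cos^2 s\,d\theta_3^2+a_4^2\cos^2(s+\tfrac{\pi}{4})\,d\theta_4^2+h^2(s)\,ds^2,$$ where $$h(s)=\sqrt{a_1^2\cos^2 s+a_2^2\cos^2(s+\tfrac{\pi}{4})+a_3^2\sin^2 s+a_4^2\sin^2(s+\tfrac{\pi}{4})}.$$ Then there exist (smooth) functions $\alpha:(0,\pi/4)\to(0,\pi)$ satisfying $$\lim_{s\to 0^+}\alpha(s)=0,\qquad \lim_{s\to\frac{\pi}{4}^-}\alpha(s)=\pi,$$ such that the map $\varphi:(Q^5,g)\to\mathbb{S}^2\subset\mathbb{R}^2\times\mathbb{R}$ given by $$\varphi(\theta_1,\theta_2,\theta_3,\theta_4,s)=\big[\sin\alpha(s)\,e^{i(k_1\theta_1+k_2\theta_2+k_3\theta_3+k_4\theta_4)},\ \cos\alpha(s)\big]$$ is a harmonic morphism; consequently $\varphi$ admits a continuous extension to the whole of ${Q^{\ast}}^5\subset\mathbb{C}^4$.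
   Context: $\mathbb{S}^2$ is the Euclidean unit sphere in $\mathbb{R}^2\times\mathbb{R}\cong\mathbb{C}\times\mathbb{R}$ with its standard metric. For $a_1,a_2,a_3,a_4>0$, ${Q^{\ast}}^5={Q^{\ast}}^5(a_1,a_2,a_3,a_4)$ is the subset of $\mathbb{C}^4$ consisting of all points $$[a_1\sin s\,e^{i\theta_1},\ a_2\sin(s+\tfrac{\pi}{4})\,e^{i\theta_2},\ a_3\cos s\,e^{i\theta_3},\ a_4\cos(s+\tfrac{\pi}{4})\,e^{i\theta_4}]$$ with $0\le\theta_1,\theta_2,\theta_3,\theta_4<2\pi$ and $0\le s\le\pi/4$. The manifold $Q^5$ is identified, through this parametrisation, with the part of ${Q^{\ast}}^5$ where $0<s<\pi/4$; the $\theta_i$ are angular coordinates on the circle factors $\mathbb{S}^1$, $s$ is the coordinate on $(0,\pi/4)$, and $g$ is the metric induced from the Euclidean structure of $\mathbb{C}^4=\mathbb{R}^8$. Continuous extension to ${Q^{\ast}}^5$ refers to the subspace topology from $\mathbb{C}^4$. A smooth map $\varphi:(M,g)\to(N,h)$ between Riemannian manifolds is harmonic if it is a critical point of the energy functional $E(\varphi)=\frac12\int_M|d\varphi|^2\,dv_g$ (equivalently, its tension field vanishes). It is a harmonic morphism if it is harmonic and horizontally weakly conformal, i.e. at each $x\in M$ either $d\varphi_x=0$, or $d\varphi_x$ restricted to $(\ker d\varphi_x)^\perp$ is surjective onto $T_{\varphi(x)}N$ and there is a number $\Lambda(x)>0$ with $\Lambda(x)\,g(X,Y)=h(d\varphi_x(X),d\varphi_x(Y))$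 for all $X,Y\in(\ker d\varphi_x)^\perp$. *)

theory Defs
  imports "HOL-Analysis.Analysis"
begin

section \<open>Smooth maps on open subsets of Euclidean spaces\<close>

text \<open>\<open>Ck_on k f S\<close>, for open \<open>S\<close>, says that \<open>f\<close> is of class \<open>C\<^sup>k\<close> on \<open>S\<close>: all directional
  derivatives are again of class \<open>C\<^sup>k\<^sup>-\<^sup>1\<close>.\<close>

primrec Ck_on ::
  "nat \<Rightarrow> ('a::euclidean_space \<Rightarrow> 'b::euclidean_space) \<Rightarrow> 'a set \<Rightarrow> bool" where
  "Ck_on 0 f S \<longleftrightarrow> continuous_on S f"
| "Ck_on (Suc k) f S \<longleftrightarrow>
     (\<forall>x\<in>S. f differentiable (at x)) \<and>
     (\<forall>v. Ck_on k (\<lambda>x. frechet_derivative f (at x) v) S)"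

definition smooth_on ::
  "'a::euclidean_space set \<Rightarrow> ('a \<Rightarrow> 'b::euclidean_space) \<Rightarrow> bool" where
  "smooth_on S f \<longleftrightarrow> (\<forall>k. Ck_on k f S)"


section \<open>Riemannian quantities in coordinates\<close>

text \<open>A Riemannian metric on an open subset of \<open>\<real>\<^sup>n\<close> is given by the field \<open>g\<close> of its Gram matrices
  with respect to the coordinate vector fields.\<close>

definition metric_inner :: "real^'n^'n \<Rightarrow> real^'n \<Rightarrow> real^'n \<Rightarrow> real" where
  "metric_inner G X Y = X \<bullet> (G *v Y)"

text \<open>\<open>|d\<phi>|\<^sup>2 = \<Sum>\<^sub>i\<^sub>j g\<^sup>i\<^sup>j \<langle>\<partial>\<^sub>i\<phi>, \<partial>\<^sub>j\<phi>\<rangle>\<close>; the target is a submanifold of a Euclidean space and carries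
  the induced metric.\<close>

definition differential_sq ::
  "(real^'n \<Rightarrow> real^'n^'n) \<Rightarrow> (real^'n \<Rightarrow> 'b::euclidean_space) \<Rightarrow> real^'n \<Rightarrow> real" where
  "differential_sq g \<phi> x =
     (\<Sum>i\<in>UNIV. \<Sum>j\<in>UNIV. matrix_inv (g x) $ i $ j *
        (frechet_derivative \<phi> (at x) (axis i 1) \<bullet> frechet_derivative \<phi> (at x) (axis j 1)))"

definition volume_density :: "(real^'n \<Rightarrow> real^'n^'n) \<Rightarrow> real^'n \<Rightarrow> real" where
  "volume_density g x = sqrt (det (g x))"

text \<open>Horizontal weak conformality at \<open>x\<close> of a map into the unit sphere, whose tangent space at \<open>p\<close>
  is the orthogonal complement of \<open>p\<close>.\<close>

definition sphere_tangent :: "'b::euclidean_space \<Rightarrow> 'b set" where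
  "sphere_tangent p = {v. p \<bullet> v = 0}"

definition horizontal_space ::
  "(real^'n \<Rightarrow> real^'n^'n) \<Rightarrow> (real^'n \<Rightarrow> 'b::euclidean_space) \<Rightarrow> real^'n \<Rightarrow> (real^'n) set" where
  "horizontal_space g \<phi> x =
     {X. \<forall>V. frechet_derivative \<phi> (at x) V = 0 \<longrightarrow> metric_inner (g x) X V = 0}"

definition horizontally_weakly_conformal_at ::
  "(real^'n \<Rightarrow> real^'n^'n) \<Rightarrow> (real^'n \<Rightarrow> 'b::euclidean_space) \<Rightarrow> real^'n \<Rightarrow> bool" where
  "horizontally_weakly_conformal_at g \<phi> x \<longleftrightarrow>
     (\<forall>X. frechet_derivative \<phi> (at x) X = 0) \<or>
     (frechet_derivative \<phi> (at x) ` horizontal_space g \<phi> x = sphere_tangent (\<phi> x) \<and>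
      (\<exists>\<Lambda>>0. \<forall>X\<in>horizontal_space g \<phi> x. \<forall>Y\<in>horizontal_space g \<phi> x.
         \<Lambda> * metric_inner (g x) X Y =
           frechet_derivative \<phi> (at x) X \<bullet> frechet_derivative \<phi> (at x) Y))"


section \<open>The manifold \<open>Q\<^sup>5\<close> and maps into the unit sphere\<close>

text \<open>A point of \<open>Q\<^sup>5 = (\<real>/2\<pi>\<int>)\<^sup>4 \<times> (0, \<pi>/4)\<close> is written in the coordinates
  \<open>(x$1, x$2, x$3, x$4, x$5) = (\<theta>\<^sub>1, \<theta>\<^sub>2, \<theta>\<^sub>3, \<theta>\<^sub>4, s)\<close>, and functions on \<open>Q\<^sup>5\<close> are functions on
  \<open>Q5_coords\<close> that are \<open>2\<pi>\<close>-periodic in each angle. (The literal \<open>5\<close> of the index type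
  equals \<open>0\<close>; the five indices are distinct.)\<close>

definition Q5_coords :: "(real^5) set" where
  "Q5_coords = {x. 0 < x$5 \<and> x$5 < pi/4}"

definition angle_periodic :: "(real^5 \<Rightarrow> 'b) \<Rightarrow> bool" where
  "angle_periodic \<phi> \<longleftrightarrow> (\<forall>x\<in>Q5_coords. \<forall>i. i \<noteq> 5 \<longrightarrow> \<phi> (x + axis i (2*pi)) = \<phi> x)"

definition smooth_sphere_map :: "(real^5 \<Rightarrow> 'b::euclidean_space) \<Rightarrow> bool" where
  "smooth_sphere_map \<phi> \<longleftrightarrow>
     smooth_on Q5_coords \<phi> \<and> angle_periodic \<phi> \<and> \<phi> ` Q5_coords \<subseteq> sphere 0 1"

text \<open>The energy \<open>\<onehalf>\<integral>|d\<phi>|\<^sup>2 dv\<^sub>g\<close> over the compact domain \<open>(\<real>/2\<pi>\<int>)\<^sup>4 \<times> [c, d]\<close> of \<open>Q\<^sup>5\<close>; every compact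
  subset of \<open>Q\<^sup>5\<close> is contained in such a domain.\<close>

definition torus_band :: "real \<Rightarrow> real \<Rightarrow> (real^5) set" where
  "torus_band c d = {x. (\<forall>i. i \<noteq> 5 \<longrightarrow> 0 \<le> x$i \<and> x$i \<le> 2*pi) \<and> c \<le> x$5 \<and> x$5 \<le> d}"

definition energy ::
  "(real^5 \<Rightarrow> real^5^5) \<Rightarrow> real \<Rightarrow> real \<Rightarrow> (real^5 \<Rightarrow> 'b::euclidean_space) \<Rightarrow> real" where
  "energy g c d \<phi> =
     1/2 * integral (torus_band c d) (\<lambda>x. differential_sq g \<phi> x * volume_density g x)"

text \<open>Since \<open>Q\<^sup>5\<close> is not compact, a critical point of the energy is understood, as usual, with
  respect to smooth variations \<open>\<Phi>\<^sub>t\<close>, \<open>|t| < \<epsilon>\<close>, that are supported in a compact domain, the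
  energy being taken over that domain.\<close>

definition compact_variation ::
  "(real^5 \<Rightarrow> 'b::euclidean_space) \<Rightarrow> real \<Rightarrow> real \<Rightarrow> real \<Rightarrow> (real \<Rightarrow> real^5 \<Rightarrow> 'b) \<Rightarrow> bool" where
  "compact_variation \<phi> \<epsilon> c d \<Phi> \<longleftrightarrow>
     smooth_on ({-\<epsilon><..<\<epsilon>} \<times> Q5_coords) (\<lambda>(t, x). \<Phi> t x) \<and>
     (\<forall>t\<in>{-\<epsilon><..<\<epsilon>}. smooth_sphere_map (\<Phi> t)) \<and>
     (\<forall>x\<in>Q5_coords. \<Phi> 0 x = \<phi> x) \<and>
     (\<forall>t\<in>{-\<epsilon><..<\<epsilon>}. \<forall>x\<in>Q5_coords. x$5 \<notin> {c..d} \<longrightarrow> \<Phi> t x = \<phi> x)"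

definition harmonic_sphere_map ::
  "(real^5 \<Rightarrow> real^5^5) \<Rightarrow> (real^5 \<Rightarrow> 'b::euclidean_space) \<Rightarrow> bool" where
  "harmonic_sphere_map g \<phi> \<longleftrightarrow>
     smooth_sphere_map \<phi> \<and>
     (\<forall>\<epsilon> c d \<Phi>. 0 < \<epsilon> \<and> 0 < c \<and> c < d \<and> d < pi/4 \<and> compact_variation \<phi> \<epsilon> c d \<Phi> \<longrightarrow>
        ((\<lambda>t. energy g c d (\<Phi> t)) has_real_derivative 0) (at 0))"

definition harmonic_morphism_sphere ::
  "(real^5 \<Rightarrow> real^5^5) \<Rightarrow> (real^5 \<Rightarrow> 'b::euclidean_space) \<Rightarrow> bool" where
  "harmonic_morphism_sphere g \<phi> \<longleftrightarrow>
     harmonic_sphere_map g \<phi> \<and>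
     (\<forall>x\<in>Q5_coords. horizontally_weakly_conformal_at g \<phi> x)"


section \<open>The metric on \<open>Q\<^sup>5\<close>, the map and the closure \<open>Q\<^sup>*\<^sup>5\<close>\<close>

definition h_fun :: "real \<Rightarrow> real \<Rightarrow> real \<Rightarrow> real \<Rightarrow> real \<Rightarrow> real" where
  "h_fun a1 a2 a3 a4 s =
     sqrt (a1\<^sup>2 * (cos s)\<^sup>2 + a2\<^sup>2 * (cos (s + pi/4))\<^sup>2
         + a3\<^sup>2 * (sin s)\<^sup>2 + a4\<^sup>2 * (sin (s + pi/4))\<^sup>2)"

definition Q5_metric :: "real \<Rightarrow> real \<Rightarrow> real \<Rightarrow> real \<Rightarrow> real^5 \<Rightarrow> real^5^5" where
  "Q5_metric a1 a2 a3 a4 x =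
     (let s = x$5 in
      \<chi> i j.
        if i \<noteq> j then 0
        else if i = 1 then a1\<^sup>2 * (sin s)\<^sup>2
        else if i = 2 then a2\<^sup>2 * (sin (s + pi/4))\<^sup>2
        else if i = 3 then a3\<^sup>2 * (cos s)\<^sup>2
        else if i = 4 then a4\<^sup>2 * (cos (s + pi/4))\<^sup>2
        else (h_fun a1 a2 a3 a4 s)\<^sup>2)"

text \<open>\<open>\<real>\<^sup>2 \<times> \<real> \<cong> \<complex> \<times> \<real>\<close> with the product norm, which is the Euclidean one.\<close>

definition phi_map ::
  "int \<Rightarrow> int \<Rightarrow> int \<Rightarrow> int \<Rightarrow> (real \<Rightarrow> real) \<Rightarrow> real^5 \<Rightarrow> complex \<times> real" where
  "phi_map k1 k2 k3 k4 \<alpha> x =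
     (of_real (sin (\<alpha> (x$5))) *
        exp (\<i> * of_real (of_int k1 * x$1 + of_int k2 * x$2 + of_int k3 * x$3 + of_int k4 * x$4)),
      cos (\<alpha> (x$5)))"

definition Q5_param ::
  "real \<Rightarrow> real \<Rightarrow> real \<Rightarrow> real \<Rightarrow> real^5 \<Rightarrow> complex \<times> complex \<times> complex \<times> complex" where
  "Q5_param a1 a2 a3 a4 x =
     (of_real (a1 * sin (x$5)) * exp (\<i> * of_real (x$1)),
      of_real (a2 * sin (x$5 + pi/4)) * exp (\<i> * of_real (x$2)),
      of_real (a3 * cos (x$5)) * exp (\<i> * of_real (x$3)),
      of_real (a4 * cos (x$5 + pi/4)) * exp (\<i> * of_real (x$4)))"

definition Q5_star ::
  "real \<Rightarrow> real \<Rightarrow> real \<Rightarrow> real \<Rightarrow> (complex \<times> complex \<times> complex \<times> complex) set" where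
  "Q5_star a1 a2 a3 a4 =
     Q5_param a1 a2 a3 a4 `
       {x. (\<forall>i. i \<noteq> 5 \<longrightarrow> 0 \<le> x$i \<and> x$i < 2*pi) \<and> 0 \<le> x$5 \<and> x$5 \<le> pi/4}"

end

theory Submission
  imports Defs
begin

text \<open>In the coframe adapted to the metric, horizontal weak conformality of the map amounts to the
  ordinary differential equation \<open>\<alpha>' = 4 h sin \<alpha> / sin 4s\<close>, because \<open>a\<^sub>i = |k\<^sub>i|\<close> gives
  \<open>\<Sum> k\<^sub>i\<^sup>2 / g\<^sub>i\<^sub>i = 16 / sin\<^sup>2 4s\<close>. It is solved by \<open>\<alpha> = 2 arctan (exp B)\<close> with
  \<open>B' = 4 h / sin 4s\<close>, and the non-integrable singularities of \<open>1 / sin 4s\<close> at both ends force the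
  boundary values. The same equation makes the tension field normal to the sphere.

  Normality of the tension field yields criticality without interchanging mixed derivatives of the variation:
  for \<open>\<psi> = \<Phi>\<^sub>t - \<phi>\<close>, integration by parts and \<open>2 \<langle>\<phi>, \<psi>\<rangle> = -|\<psi>|\<^sup>2\<close> (both maps have unit length)
  turn the energy difference into an integral of quadratic expressions in \<open>\<psi>\<close> and \<open>d\<psi>\<close>,
  which is \<open>O(t\<^sup>2)\<close>.

  The map extends to \<open>Q\<^sup>*\<^sup>5\<close> because it extends continuously to the closed parameter box and is
  constant on the fibres of the parametrisation, which is a quotient map by compactness.\<close>

section \<open>Calculus of smooth maps\<close>

text \<open>\<open>frechet_derivative\<close> is a choice among the derivatives at a point.
  Functions that agree near the point have the same derivatives there, hence the same choice, even
  where none exists.\<close>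

lemma frechet_derivative_cong_open:
  assumes "open S" "x \<in> S" "\<And>y. y \<in> S \<Longrightarrow> f y = g y"
  shows "frechet_derivative f (at x) = frechet_derivative g (at x)"
proof -
  have "(f has_derivative D) (at x) \<longleftrightarrow> (g has_derivative D) (at x)" for D
    using has_derivative_transform_within_open[OF _ assms(1,2)] assms(3) by metis
  then show ?thesis by (simp add: frechet_derivative_def)
qed

lemma Ck_on_cong:
  assumes "open S" "\<And>x. x \<in> S \<Longrightarrow> f x = g x" "Ck_on k f S"
  shows "Ck_on k g S"
  using assms
proof (induction k arbitrary: f g)
  case 0
  then show ?case by (simp cong: continuous_on_cong)
next
  case (Suc k)
  have iff: "(f has_derivative D) (at x) \<longleftrightarrow> (g has_derivative D) (at x)" if "x \<in> S" for x D
    using has_derivative_transform_within_open[OF _ \<open>open S\<close> that] Suc.prems(2) by metis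
  have eq: "frechet_derivative f (at x) = frechet_derivative g (at x)" if "x \<in> S" for x
    by (rule frechet_derivative_cong_open[OF \<open>open S\<close> that Suc.prems(2)])
  have "g differentiable (at x)" if "x \<in> S" for x
    using Suc.prems(3) iff that by (auto simp: differentiable_def)
  moreover have "Ck_on k (\<lambda>x. frechet_derivative g (at x) v) S" for v
  proof (rule Suc.IH[OF \<open>open S\<close>])
    show "frechet_derivative f (at x) v = frechet_derivative g (at x) v" if "x \<in> S" for x
      using eq[OF that] by simp
    show "Ck_on k (\<lambda>x. frechet_derivative f (at x) v) S"
      using Suc.prems(3) by simp
  qed
  ultimately show ?case by simp
qed

text \<open>The recursion of \<open>Ck_on\<close> peels off the first derivative, so lowering the
  order is itself an induction; its base is that differentiability implies continuity.\<close>

lemma Ck_on_SucD: "Ck_on (Suc k) f S \<Longrightarrow> Ck_on k f S"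
proof (induction k arbitrary: f)
  case 0
  then show ?case
    by (auto intro!: differentiable_imp_continuous_on
        simp: differentiable_on_def differentiable_at_withinI)
next
  case (Suc k)
  then show ?case by (metis Ck_on.simps(2))
qed

text \<open>By uniqueness of derivatives an explicit \<open>D\<close> may stand in for
  \<open>frechet_derivative\<close>. The closure rules below rest on this: differentiate by a
  calculus rule, then apply the induction hypothesis to the resulting formula.\<close>

lemma Ck_on_SucI:
  assumes "open S" "\<And>x. x \<in> S \<Longrightarrow> (f has_derivative D x) (at x)"
    "\<And>v. Ck_on k (\<lambda>x. D x v) S"
  shows "Ck_on (Suc k) f S"
proof -
  have eq: "D x = frechet_derivative f (at x)" if "x \<in> S" for x
    using assms(2) that frechet_derivative_at by blast
  have "Ck_on k (\<lambda>x. frechet_derivative f (at x) v) S" for v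
    by (rule Ck_on_cong[OF assms(1) _ assms(3)[of v]]) (simp add: eq)
  then show ?thesis using assms(2) by (auto simp: differentiable_def)
qed

lemma Ck_on_has_derivative:
  assumes "Ck_on (Suc k) f S" "x \<in> S"
  shows "(f has_derivative frechet_derivative f (at x)) (at x)"
  using assms frechet_derivative_works by auto

lemma Ck_on_frechet_derivative:
  "Ck_on (Suc k) f S \<Longrightarrow> Ck_on k (\<lambda>x. frechet_derivative f (at x) v) S"
  by (simp only: Ck_on.simps)

lemma Ck_on_const: "Ck_on k (\<lambda>x. c) S"
  by (induction k arbitrary: c) auto

lemma Ck_on_bounded_linear:
  assumes "open S" "bounded_linear L" "Ck_on k f S"
  shows "Ck_on k (\<lambda>x. L (f x)) S"
  using assms(3)
proof (induction k arbitrary: f)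
  case 0
  then show ?case using assms(2) by (auto intro: bounded_linear.continuous_on)
next
  case (Suc k)
  show ?case
  proof (rule Ck_on_SucI[OF \<open>open S\<close>])
    show "((\<lambda>x. L (f x)) has_derivative (\<lambda>v. L (frechet_derivative f (at x) v))) (at x)"
      if "x \<in> S" for x
      using bounded_linear.has_derivative[OF assms(2) Ck_on_has_derivative[OF Suc.prems that]] .
    show "Ck_on k (\<lambda>x. L (frechet_derivative f (at x) v)) S" for v
      by (rule Suc.IH) (use Suc.prems in simp)
  qed
qed

lemma Ck_on_add:
  assumes "open S" "Ck_on k f S" "Ck_on k g S"
  shows "Ck_on k (\<lambda>x. f x + g x) S"
  using assms(2,3)
proof (induction k arbitrary: f g)
  case 0
  then show ?case by (auto intro: continuous_intros)
next
  case (Suc k)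
  show ?case
  proof (rule Ck_on_SucI[OF \<open>open S\<close>])
    show "((\<lambda>x. f x + g x) has_derivative
      (\<lambda>v. frechet_derivative f (at x) v + frechet_derivative g (at x) v)) (at x)"
      if "x \<in> S" for x
      using has_derivative_add[OF Ck_on_has_derivative[OF Suc.prems(1) that]
        Ck_on_has_derivative[OF Suc.prems(2) that]] .
    show "Ck_on k (\<lambda>x. frechet_derivative f (at x) v + frechet_derivative g (at x) v) S" for v
      by (rule Suc.IH) (use Suc.prems in simp_all)
  qed
qed

lemma Ck_on_sum:
  assumes "open S" "\<And>i. i \<in> I \<Longrightarrow> Ck_on k (f i) S"
  shows "Ck_on k (\<lambda>x. \<Sum>i\<in>I. f i x) S"
  using assms(2)
  by (induction I rule: infinite_finite_induct) (simp_all add: Ck_on_add[OF \<open>open S\<close>] Ck_on_const)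

lemma Ck_on_id: "open S \<Longrightarrow> Ck_on k (\<lambda>x. x) S"
proof (cases k)
  case (Suc j)
  show "open S \<Longrightarrow> ?thesis"
    unfolding Suc by (rule Ck_on_SucI[OF _ has_derivative_ident Ck_on_const])
qed auto

text \<open>The product rule leaves undifferentiated factors, which are brought down to order
  \<open>k\<close> by \<open>Ck_on_SucD\<close> so that the induction hypothesis applies to both
  summands.\<close>

lemma Ck_on_bounded_bilinear:
  assumes "open S" "bounded_bilinear P" "Ck_on k f S" "Ck_on k g S"
  shows "Ck_on k (\<lambda>x. P (f x) (g x)) S"
  using assms(3,4)
proof (induction k arbitrary: f g)
  case 0
  then show ?case using assms(2) by (auto intro: bounded_bilinear.continuous_on)
next
  case (Suc k)
  show ?case
  proof (rule Ck_on_SucI[OF \<open>open S\<close>])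
    show "((\<lambda>x. P (f x) (g x)) has_derivative
      (\<lambda>v. P (f x) (frechet_derivative g (at x) v) + P (frechet_derivative f (at x) v) (g x))) (at x)"
      if "x \<in> S" for x
      using bounded_bilinear.FDERIV[OF assms(2) Ck_on_has_derivative[OF Suc.prems(1) that]
        Ck_on_has_derivative[OF Suc.prems(2) that]] .
    show "Ck_on k (\<lambda>x. P (f x) (frechet_derivative g (at x) v)
        + P (frechet_derivative f (at x) v) (g x)) S" for v
      using Suc.prems
      by (intro Ck_on_add[OF \<open>open S\<close>] Suc.IH Suc.prems[THEN Ck_on_SucD]) simp_all
  qed
qed

text \<open>The chain rule evaluates the derivative of \<open>g\<close> in the direction
  \<open>?f' x v\<close>, which moves with \<open>x\<close>, whereas \<open>Ck_on\<close> controls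
  fixed directions. Expanding that direction in \<open>Basis\<close> gives a sum of products of
  functions of class \<open>k\<close>.\<close>

lemma Ck_on_compose:
  fixes f :: "'a::euclidean_space \<Rightarrow> 'b::euclidean_space" and g :: "'b \<Rightarrow> 'c::euclidean_space"
  assumes "open S" "open T" "f ` S \<subseteq> T" "Ck_on k f S" "Ck_on k g T"
  shows "Ck_on k (\<lambda>x. g (f x)) S"
  using assms(4,5)
proof (induction k arbitrary: g)
  case 0
  then show ?case using assms(3) by (auto intro: continuous_on_compose2)
next
  case (Suc k)
  let ?f' = "\<lambda>x. frechet_derivative f (at x)" and ?g' = "\<lambda>x. frechet_derivative g (at x)"
  have f': "(f has_derivative ?f' x) (at x)" if "x \<in> S" for x
    using Ck_on_has_derivative[OF Suc.prems(1) that] .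
  have g': "(g has_derivative ?g' (f x)) (at (f x))" if "x \<in> S" for x
    using Ck_on_has_derivative[OF Suc.prems(2)] assms(3) that by blast
  show ?case
  proof (rule Ck_on_SucI[OF \<open>open S\<close>])
    show "((\<lambda>x. g (f x)) has_derivative
        (\<lambda>v. \<Sum>b\<in>Basis. (?f' x v \<bullet> b) *\<^sub>R ?g' (f x) b)) (at x)" if "x \<in> S" for x
    proof -
      have "linear (?g' (f x))" using g'[OF that] has_derivative_linear by blast
      then have expand: "?g' (f x) w = (\<Sum>b\<in>Basis. (w \<bullet> b) *\<^sub>R ?g' (f x) b)" for w
        by (subst euclidean_representation[of w, symmetric])
          (simp add: linear_sum linear_cmul del: euclidean_representation)
      have "?g' (f x) \<circ> ?f' x = (\<lambda>v. \<Sum>b\<in>Basis. (?f' x v \<bullet> b) *\<^sub>R ?g' (f x) b)"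
        unfolding o_def by (rule ext) (rule expand)
      then show ?thesis
        using diff_chain_at[OF f'[OF that] g'[OF that]] by (simp add: o_def)
    qed
    show "Ck_on k (\<lambda>x. \<Sum>b\<in>Basis. (?f' x v \<bullet> b) *\<^sub>R ?g' (f x) b) S" for v
    proof (intro Ck_on_sum \<open>open S\<close> Ck_on_bounded_bilinear[OF \<open>open S\<close> bounded_bilinear_scaleR])
      show "Ck_on k (\<lambda>x. ?f' x v \<bullet> b) S" for b
        by (rule Ck_on_bounded_linear[OF \<open>open S\<close> bounded_linear_inner_left])
          (use Suc.prems(1) in simp)
      show "Ck_on k (\<lambda>x. ?g' (f x) b) S" for b
        by (rule Suc.IH[OF Ck_on_SucD[OF Suc.prems(1)]]) (use Suc.prems(2) in simp)
    qed
  qed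
qed

lemma smooth_on_const: "smooth_on S (\<lambda>x. c)"
  by (simp add: smooth_on_def Ck_on_const)

lemma smooth_on_cong:
  "open S \<Longrightarrow> (\<And>x. x \<in> S \<Longrightarrow> f x = g x) \<Longrightarrow> smooth_on S f \<Longrightarrow> smooth_on S g"
  unfolding smooth_on_def using Ck_on_cong by blast

lemma smooth_on_bounded_linear:
  "open S \<Longrightarrow> bounded_linear L \<Longrightarrow> smooth_on S f \<Longrightarrow> smooth_on S (\<lambda>x. L (f x))"
  by (simp add: smooth_on_def Ck_on_bounded_linear)

lemma smooth_on_linear:
  "open S \<Longrightarrow> bounded_linear L \<Longrightarrow> smooth_on S L"
  using smooth_on_bounded_linear[of S L "\<lambda>x. x"] by (simp add: smooth_on_def Ck_on_id)

lemma smooth_on_add: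
  "open S \<Longrightarrow> smooth_on S f \<Longrightarrow> smooth_on S g \<Longrightarrow> smooth_on S (\<lambda>x. f x + g x)"
  by (simp add: smooth_on_def Ck_on_add)

lemma smooth_on_mult:
  fixes f g :: "_ \<Rightarrow> real"
  shows "open S \<Longrightarrow> smooth_on S f \<Longrightarrow> smooth_on S g \<Longrightarrow> smooth_on S (\<lambda>x. f x * g x)"
  by (simp add: smooth_on_def Ck_on_bounded_bilinear[OF _ bounded_bilinear_mult])

lemma smooth_on_scaleR:
  "open S \<Longrightarrow> smooth_on S f \<Longrightarrow> smooth_on S g \<Longrightarrow> smooth_on S (\<lambda>x. f x *\<^sub>R g x)"
  by (simp add: smooth_on_def Ck_on_bounded_bilinear[OF _ bounded_bilinear_scaleR])

lemma smooth_on_compose: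
  assumes "smooth_on T g" "open S" "open T" "smooth_on S f" "\<And>x. x \<in> S \<Longrightarrow> f x \<in> T"
  shows "smooth_on S (\<lambda>x. g (f x))"
  unfolding smooth_on_def
proof
  show "Ck_on k (\<lambda>x. g (f x)) S" for k
    by (rule Ck_on_compose[OF assms(2,3)]) (use assms in \<open>auto simp: smooth_on_def\<close>)
qed

section \<open>Smoothness of elementary functions of a real variable\<close>

lemma Ck_on_real_Suc:
  fixes f f' :: "real \<Rightarrow> real"
  assumes "open S" "\<And>x. x \<in> S \<Longrightarrow> (f has_real_derivative f' x) (at x)" "Ck_on k f' S"
  shows "Ck_on (Suc k) f S"
proof (rule Ck_on_SucI[OF \<open>open S\<close>])
  show "(f has_derivative (\<lambda>v. f' x * v)) (at x)" if "x \<in> S" for x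
    using assms(2)[OF that] by (simp add: has_field_derivative_def)
  show "Ck_on k (\<lambda>x. f' x * v) S" for v
    using Ck_on_bounded_linear[OF \<open>open S\<close> bounded_linear_mult_left assms(3)] .
qed

lemma smooth_on_real_antiderivative:
  fixes f f' :: "real \<Rightarrow> real"
  assumes "open S" "\<And>x. x \<in> S \<Longrightarrow> (f has_real_derivative f' x) (at x)" "smooth_on S f'"
  shows "smooth_on S f"
  unfolding smooth_on_def
proof
  fix k
  have "Ck_on k f' S" using assms(3) by (simp only: smooth_on_def)
  from Ck_on_real_Suc[OF assms(1,2) this] show "Ck_on k f S" by (rule Ck_on_SucD)
qed

text \<open>Each function is, up to sign, the derivative of the other, so both claims go through one
  induction.\<close>

lemma Ck_on_real_sin_cos:
  "Ck_on k (sin :: real \<Rightarrow> real) UNIV" "Ck_on k (cos :: real \<Rightarrow> real) UNIV"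
proof (induction k)
  case (Suc k)
  { case 1 show ?case
      by (rule Ck_on_real_Suc[OF _ _ Suc(2)]) (auto intro!: derivative_eq_intros) }
  { case 2 show ?case
      by (rule Ck_on_real_Suc[OF _ _ Ck_on_bounded_linear[OF _ bounded_linear_minus[OF bounded_linear_ident] Suc(1)]])
        (auto intro!: derivative_eq_intros) }
qed (auto intro: continuous_intros)

lemma smooth_on_sin:
  fixes f :: "_ \<Rightarrow> real"
  shows "open S \<Longrightarrow> smooth_on S f \<Longrightarrow> smooth_on S (\<lambda>x. sin (f x))"
  using smooth_on_compose[of UNIV sin S f] Ck_on_real_sin_cos by (simp add: smooth_on_def)

lemma smooth_on_cos:
  fixes f :: "_ \<Rightarrow> real"
  shows "open S \<Longrightarrow> smooth_on S f \<Longrightarrow> smooth_on S (\<lambda>x. cos (f x))"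
  using smooth_on_compose[of UNIV cos S f] Ck_on_real_sin_cos by (simp add: smooth_on_def)

lemma Ck_on_real_exp: "Ck_on k (exp :: real \<Rightarrow> real) UNIV"
proof (induction k)
  case (Suc k)
  then show ?case by (rule Ck_on_real_Suc[OF open_UNIV DERIV_exp])
qed (auto intro: continuous_intros)

lemma smooth_on_exp:
  fixes f :: "_ \<Rightarrow> real"
  shows "open S \<Longrightarrow> smooth_on S f \<Longrightarrow> smooth_on S (\<lambda>x. exp (f x))"
  using smooth_on_compose[of UNIV exp S f] Ck_on_real_exp by (simp add: smooth_on_def)

lemma open_nonzero: "open {x::real. x \<noteq> 0}"
  by (simp add: open_Collect_neq)

lemma Ck_on_real_inverse: "Ck_on k (inverse :: real \<Rightarrow> real) {x. x \<noteq> 0}"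
proof (induction k)
  case 0
  show ?case by (auto intro: continuous_intros)
next
  case (Suc k)
  show ?case
    by (rule Ck_on_real_Suc[OF open_nonzero _
          Ck_on_bounded_linear[OF open_nonzero bounded_linear_minus[OF bounded_linear_ident]
            Ck_on_bounded_bilinear[OF open_nonzero bounded_bilinear_mult Suc Suc]]])
      (auto intro!: derivative_eq_intros)
qed

lemma smooth_on_inverse:
  fixes f :: "_ \<Rightarrow> real"
  shows "open S \<Longrightarrow> smooth_on S f \<Longrightarrow> (\<And>x. x \<in> S \<Longrightarrow> f x \<noteq> 0) \<Longrightarrow> smooth_on S (\<lambda>x. inverse (f x))"
  using smooth_on_compose[of "{x. x \<noteq> 0}" inverse S f] Ck_on_real_inverse open_nonzero
  by (simp add: smooth_on_def)

text \<open>The derivative \<open>1 / (2 * sqrt x)\<close> contains \<open>sqrt\<close> itself,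
  which has order \<open>k\<close> by induction and is nonzero, so composition with
  \<open>inverse\<close> is available.\<close>

lemma Ck_on_real_sqrt: "Ck_on k sqrt {0<..}"
proof (induction k)
  case 0
  show ?case by (auto intro: continuous_intros)
next
  case (Suc k)
  have "Ck_on k (\<lambda>x. inverse (sqrt x)) {0<..}"
    by (rule Ck_on_compose[OF _ open_nonzero _ Suc Ck_on_real_inverse]) auto
  then have "Ck_on k (\<lambda>x. inverse (sqrt x) * (1/2)) {0<..}"
    by (intro Ck_on_bounded_linear[OF _ bounded_linear_mult_left]) auto
  then show ?case
    by (rule Ck_on_real_Suc[rotated 2]) (auto intro!: derivative_eq_intros)
qed

lemma smooth_on_sqrt:
  fixes f :: "_ \<Rightarrow> real"
  shows "open S \<Longrightarrow> smooth_on S f \<Longrightarrow> (\<And>x. x \<in> S \<Longrightarrow> f x > 0) \<Longrightarrow> smooth_on S (\<lambda>x. sqrt (f x))"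
  using smooth_on_compose[of "{0<..}" sqrt S f] Ck_on_real_sqrt by (simp add: smooth_on_def)

lemma smooth_on_arctan:
  fixes f :: "_ \<Rightarrow> real"
  assumes "open S" "smooth_on S f"
  shows "smooth_on S (\<lambda>x. arctan (f x))"
proof -
  have "1 + y * y \<noteq> 0" for y :: real
    using zero_le_square[of y] by linarith
  then have "smooth_on UNIV (\<lambda>y::real. inverse (1 + y * y))"
    by (intro smooth_on_inverse smooth_on_add smooth_on_const smooth_on_mult
        smooth_on_linear bounded_linear_ident) auto
  then have "smooth_on UNIV arctan"
    by (rule smooth_on_real_antiderivative[rotated 2])
      (auto intro!: derivative_eq_intros simp: power2_eq_square)
  from smooth_on_compose[OF this assms(1) _ assms(2)] show ?thesis by simp
qed

section \<open>Integration by parts and the first variation\<close>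

text \<open>Fubini: Lebesgue measure is the image of a product of one-dimensional measures, and the
  \<open>i\<close>-th coordinate is integrated first. The remaining coordinates form a base point
  \<open>z\<close> orthogonal to \<open>i\<close>.\<close>

lemma lborel_integral_lines_zero:
  fixes f :: "'a::euclidean_space \<Rightarrow> real"
  assumes "integrable lborel f" "i \<in> Basis"
    and lines: "\<And>z. z \<bullet> i = 0 \<Longrightarrow> (\<integral>y. f (z + y *\<^sub>R i) \<partial>lborel) = 0"
  shows "integral\<^sup>L lborel f = 0"
proof -
  interpret product_sigma_finite "\<lambda>_::'a. lborel :: real measure" ..
  let ?S = "\<lambda>x. \<Sum>b\<in>Basis. x b *\<^sub>R b :: 'a"
  have ins: "insert i (Basis - {i}) = Basis" using assms(2) by blast
  have meas: "?S \<in> measurable (\<Pi>\<^sub>M b\<in>Basis. lborel) borel" by measurable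
  have int: "integrable (\<Pi>\<^sub>M b\<in>insert i (Basis - {i}). lborel) (\<lambda>x. f (?S x))"
    unfolding ins using assms(1) integrable_distr[OF meas, of f] by (simp add: lborel_eq[where 'a='a])
  have "f \<in> borel_measurable borel" using assms(1) borel_measurable_integrable by fastforce
  then have "integral\<^sup>L lborel f = (\<integral>x. f (?S x) \<partial>(\<Pi>\<^sub>M b\<in>insert i (Basis - {i}). lborel))"
    unfolding ins using meas by (simp add: lborel_eq[where 'a='a] integral_distr)
  also have "\<dots> = (\<integral>x. (\<integral>y. f (?S (x(i := y))) \<partial>lborel) \<partial>(\<Pi>\<^sub>M b\<in>Basis - {i}. lborel))"
    using int by (intro product_integral_insert) auto
  also have "(\<lambda>x. \<integral>y. f (?S (x(i := y))) \<partial>lborel) = (\<lambda>x. 0)"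
  proof
    fix x :: "'a \<Rightarrow> real"
    let ?z = "\<Sum>b\<in>Basis - {i}. x b *\<^sub>R b"
    have "?S (x(i := y)) = ?z + y *\<^sub>R i" for y
      using assms(2) by (simp add: sum.remove)
    moreover have "?z \<bullet> i = 0"
      using assms(2) by (auto simp: inner_sum_left inner_Basis intro!: sum.neutral)
    ultimately show "(\<integral>y. f (?S (x(i := y))) \<partial>lborel) = 0"
      using lines by simp
  qed
  finally show ?thesis by simp
qed

text \<open>On each line parallel to \<open>i\<close> the fundamental theorem of calculus gives the
  difference of \<open>F\<close> between opposite faces, which vanishes by \<open>faces\<close>.
  Periodic functions and functions that vanish on both faces meet this condition.\<close>

lemma integral_cbox_directional_derivative_zero:
  fixes F F' :: "'a::euclidean_space \<Rightarrow> real"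
  assumes "i \<in> Basis" and cont: "continuous_on (cbox u v) F'"
    and der: "\<And>x. x \<in> cbox u v \<Longrightarrow> ((\<lambda>\<tau>. F (x + \<tau> *\<^sub>R i)) has_real_derivative F' x) (at 0)"
    and faces: "\<And>x. x \<in> cbox u v \<Longrightarrow> x \<bullet> i = u \<bullet> i \<Longrightarrow> F (x + (v \<bullet> i - u \<bullet> i) *\<^sub>R i) = F x"
  shows "integral (cbox u v) F' = 0"
proof -
  let ?f = "\<lambda>x. indicator (cbox u v) x *\<^sub>R F' x"
  have int: "integrable lborel ?f"
    by (rule borel_integrable_compact[OF compact_cbox cont])
  have "integral\<^sup>L lborel ?f = 0"
  proof (rule lborel_integral_lines_zero[OF int assms(1)])
    fix z :: 'a assume z: "z \<bullet> i = 0"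
    show "(\<integral>y. ?f (z + y *\<^sub>R i) \<partial>lborel) = 0"
    proof (cases "\<exists>y. z + y *\<^sub>R i \<in> cbox u v")
      case False
      then show ?thesis by simp
    next
      case True
      then obtain y0 where y0: "z + y0 *\<^sub>R i \<in> cbox u v" by blast
      have coord: "(z + y *\<^sub>R i) \<bullet> b = (if b = i then y else z \<bullet> b)" if "b \<in> Basis" for y b
        using that assms(1) z by (auto simp: inner_add_left inner_Basis)
      \<comment> \<open>The line meets the box at \<open>y0\<close>, so all coordinates other than
        the \<open>i\<close>-th are within bounds along the whole line.\<close>
      have le: "u \<bullet> i \<le> v \<bullet> i" and mem: "z + y *\<^sub>R i \<in> cbox u v \<longleftrightarrow> y \<in> {u \<bullet> i..v \<bullet> i}" for y
        using y0 assms(1) by (force simp: mem_box coord)+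
      have "((\<lambda>y. F (z + y *\<^sub>R i)) has_vector_derivative F' (z + y *\<^sub>R i)) (at y within {u \<bullet> i..v \<bullet> i})"
        if "u \<bullet> i \<le> y" "y \<le> v \<bullet> i" for y
      proof -
        have "((\<lambda>\<tau>. F (z + (\<tau> + y) *\<^sub>R i)) has_real_derivative F' (z + y *\<^sub>R i)) (at 0)"
          using der[of "z + y *\<^sub>R i"] that mem by (simp add: algebra_simps)
        then have "((\<lambda>y. F (z + y *\<^sub>R i)) has_real_derivative F' (z + y *\<^sub>R i)) (at y)"
          using DERIV_shift[of "\<lambda>y. F (z + y *\<^sub>R i)" _ 0 y] by simp
        then show ?thesis
          using has_real_derivative_iff_has_vector_derivative has_vector_derivative_at_within by blast
      qed
      moreover have "continuous_on {u \<bullet> i..v \<bullet> i} (\<lambda>y. F' (z + y *\<^sub>R i))"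
        by (rule continuous_on_compose2[OF cont]) (auto intro!: continuous_intros simp: mem)
      ultimately have "(\<integral>y. indicator {u \<bullet> i..v \<bullet> i} y *\<^sub>R F' (z + y *\<^sub>R i) \<partial>lborel)
          = F (z + (v \<bullet> i) *\<^sub>R i) - F (z + (u \<bullet> i) *\<^sub>R i)"
        by (intro integral_FTC_atLeastAtMost[OF le]) auto
      also have "\<dots> = 0"
      proof -
        have "z + (u \<bullet> i) *\<^sub>R i + (v \<bullet> i - u \<bullet> i) *\<^sub>R i = z + (v \<bullet> i) *\<^sub>R i"
          by (simp add: scaleR_left_diff_distrib)
        moreover have "z + (u \<bullet> i) *\<^sub>R i \<in> cbox u v" using le by (simp add: mem)
        ultimately have "F (z + (v \<bullet> i) *\<^sub>R i) = F (z + (u \<bullet> i) *\<^sub>R i)"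
          using faces[of "z + (u \<bullet> i) *\<^sub>R i"] coord[OF assms(1), of "u \<bullet> i"] by metis
        then show ?thesis by simp
      qed
      also have "(\<lambda>y. indicator {u \<bullet> i..v \<bullet> i} y *\<^sub>R F' (z + y *\<^sub>R i)) = (\<lambda>y. ?f (z + y *\<^sub>R i))"
        by (simp add: indicator_def mem)
      finally show ?thesis .
    qed
  qed
  moreover have "set_integrable lborel (cbox u v) F'"
    using int by (simp add: set_integrable_def)
  ultimately show ?thesis
    using set_borel_integral_eq_integral(2) by (fastforce simp: set_lebesgue_integral_def)
qed

text \<open>The mean value inequality in the parameter, with \<open>x\<close> held fixed. Halving
  \<open>\<epsilon>\<close> yields a compact parameter interval inside the open one, so the
  continuous parameter derivative is bounded on its product with \<open>K\<close>.\<close>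

lemma Ck_on_lipschitz_in_parameter:
  fixes G :: "real \<times> 'a::euclidean_space \<Rightarrow> 'b::euclidean_space"
  assumes "Ck_on (Suc 0) G ({-\<epsilon><..<\<epsilon>} \<times> S)" "compact K" "K \<subseteq> S" "0 < \<epsilon>"
  obtains C where "0 \<le> C"
    "\<And>t x. \<bar>t\<bar> \<le> \<epsilon>/2 \<Longrightarrow> x \<in> K \<Longrightarrow> norm (G (t, x) - G (0, x)) \<le> C * \<bar>t\<bar>"
proof -
  let ?D = "\<lambda>p. frechet_derivative G (at p) (1, 0)"
  let ?I = "{-(\<epsilon>/2)..\<epsilon>/2}"
  have sub: "?I \<times> K \<subseteq> {-\<epsilon><..<\<epsilon>} \<times> S" using assms(3,4) by auto
  have "continuous_on (?I \<times> K) ?D"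
    by (rule continuous_on_subset[OF Ck_on_frechet_derivative[OF assms(1), unfolded Ck_on.simps] sub])
  then have "bounded (?D ` (?I \<times> K))"
    using assms(2) by (intro compact_imp_bounded compact_continuous_image compact_Times) auto
  then obtain C where C: "C > 0" "\<And>p. p \<in> ?I \<times> K \<Longrightarrow> norm (?D p) \<le> C"
    unfolding bounded_pos by auto
  have "norm (G (t, x) - G (0, x)) \<le> C * \<bar>t\<bar>" if "\<bar>t\<bar> \<le> \<epsilon>/2" "x \<in> K" for t x
  proof -
    have der: "((\<lambda>\<tau>. G (\<tau>, x)) has_derivative (\<lambda>h. h *\<^sub>R ?D (\<tau>, x))) (at \<tau> within ?I)"
      if "\<tau> \<in> ?I" for \<tau>
    proof -
      have G: "(G has_derivative frechet_derivative G (at (\<tau>, x))) (at (\<tau>, x))"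
        using assms(3,4) that \<open>x \<in> K\<close> by (intro Ck_on_has_derivative[OF assms(1)]) auto
      have "((\<lambda>\<tau>. (\<tau>, x)) has_derivative (\<lambda>h. (h, 0))) (at \<tau>)"
        by (auto intro!: derivative_eq_intros)
      from diff_chain_at[OF this G]
      have "((\<lambda>\<tau>. G (\<tau>, x)) has_derivative (\<lambda>h. frechet_derivative G (at (\<tau>, x)) (h, 0))) (at \<tau>)"
        by (simp add: o_def)
      moreover have "frechet_derivative G (at (\<tau>, x)) (h, 0) = h *\<^sub>R ?D (\<tau>, x)" for h
        using linear_cmul[OF has_derivative_linear[OF G], of h "(1, 0)"] by simp
      then have "(\<lambda>h. frechet_derivative G (at (\<tau>, x)) (h, 0)) = (\<lambda>h. h *\<^sub>R ?D (\<tau>, x))"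
        by (rule ext)
      ultimately have "((\<lambda>\<tau>. G (\<tau>, x)) has_derivative (\<lambda>h. h *\<^sub>R ?D (\<tau>, x))) (at \<tau>)"
        by (simp only:)
      then show ?thesis by (rule has_derivative_at_withinI)
    qed
    have bd: "onorm (\<lambda>h. h *\<^sub>R ?D (\<tau>, x)) \<le> C" if "\<tau> \<in> ?I" for \<tau>
    proof (rule onorm_bound)
      have "norm (?D (\<tau>, x)) \<le> C" using C(2) that \<open>x \<in> K\<close> by blast
      then show "norm (h *\<^sub>R ?D (\<tau>, x)) \<le> C * norm h" for h
        by (simp add: mult.commute[of C] mult_left_mono)
    qed (use C(1) in simp)
    show ?thesis
    proof -
      have "t \<in> ?I" "0 \<in> ?I" using that by auto
      from differentiable_bound[OF convex_real_interval(5) der bd this] show ?thesis by simp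
    qed
  qed
  with C(1) show ?thesis by (intro that[of C]) auto
qed

lemma has_real_derivative_zero_if_quadratic:
  fixes e :: "real \<Rightarrow> real"
  assumes "0 < \<delta>" "\<And>t. \<bar>t\<bar> \<le> \<delta> \<Longrightarrow> \<bar>e t - e 0\<bar> \<le> C * t\<^sup>2"
  shows "(e has_real_derivative 0) (at 0)"
proof -
  have "eventually (\<lambda>t. norm ((e t - e 0) / (t - 0)) \<le> C * \<bar>t\<bar>) (at 0)"
    unfolding eventually_at
  proof (intro exI[of _ \<delta>] conjI ballI impI assms(1))
    fix t :: real assume t: "t \<noteq> 0 \<and> dist t 0 < \<delta>"
    then have "\<bar>e t - e 0\<bar> \<le> C * \<bar>t\<bar> * \<bar>t\<bar>"
      using assms(2)[of t] by (simp add: power2_eq_square)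
    with t show "norm ((e t - e 0) / (t - 0)) \<le> C * \<bar>t\<bar>"
      by (simp add: divide_le_eq)
  qed
  moreover have "((\<lambda>t. C * \<bar>t\<bar>) \<longlongrightarrow> 0) (at 0)"
    by (auto intro!: tendsto_eq_intros)
  ultimately have "((\<lambda>t. (e t - e 0) / (t - 0)) \<longlongrightarrow> 0) (at 0)"
    by (rule Lim_null_comparison)
  then show ?thesis by (simp add: has_field_derivative_iff)
qed

section \<open>The five coordinates, diagonal metrics and periodic sphere maps\<close>

lemma exhaust_5:
  fixes i :: 5
  shows "i = 1 \<or> i = 2 \<or> i = 3 \<or> i = 4 \<or> i = 5"
proof (induct i)
  case (of_int z)
  \<comment> \<open>The representatives run from 0 to 4, and the residue 0 is the index written
    5.\<close>
  then have "z = 0 \<or> z = 1 \<or> z = 2 \<or> z = 3 \<or> z = 4" by fastforce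
  then show ?case by auto
qed

lemma UNIV_5: "UNIV = {1, 2, 3, 4, 5::5}"
  using exhaust_5 by auto

lemma sum_5: "sum f (UNIV::5 set) = f 1 + f 2 + f 3 + f 4 + f 5"
  unfolding UNIV_5 by (simp add: ac_simps)

text \<open>\<open>matrix_inv\<close> is a choice operator. The explicit two-sided inverse
  \<open>?B\<close> shows that the choice is among actual inverses, and uniqueness of inverses
  identifies the chosen matrix with \<open>?B\<close>.\<close>

lemma matrix_inv_diagonal:
  fixes A :: "real^'n^'n"
  assumes "\<And>i j. i \<noteq> j \<Longrightarrow> A $ i $ j = 0" "\<And>i. A $ i $ i \<noteq> 0"
  shows "matrix_inv A $ i $ j = (if i = j then inverse (A $ i $ i) else 0)"
proof -
  let ?B = "\<chi> i j. if i = j then inverse (A $ i $ i) else 0"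
  have l: "(A ** ?B) $ i $ j = mat 1 $ i $ j" for i j
  proof -
    have "(A ** ?B) $ i $ j = (\<Sum>k\<in>UNIV. if k = j then A $ i $ k * inverse (A $ k $ k) else 0)"
      unfolding matrix_matrix_mult_def vec_lambda_beta by (rule sum.cong) simp_all
    also have "\<dots> = mat 1 $ i $ j" using assms by (simp add: mat_def)
    finally show ?thesis .
  qed
  have r: "(?B ** A) $ i $ j = mat 1 $ i $ j" for i j
  proof -
    have "(?B ** A) $ i $ j = (\<Sum>k\<in>UNIV. if i = k then inverse (A $ i $ i) * A $ k $ j else 0)"
      unfolding matrix_matrix_mult_def vec_lambda_beta by (rule sum.cong) simp_all
    also have "\<dots> = mat 1 $ i $ j" using assms by (simp add: mat_def)
    finally show ?thesis .
  qed
  have B: "A ** ?B = mat 1" "?B ** A = mat 1"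
    unfolding vec_eq_iff using l r by blast+
  then have "\<exists>B. A ** B = mat 1 \<and> B ** A = mat 1" by blast
  from someI_ex[OF this] have ex: "matrix_inv A ** A = mat 1"
    unfolding matrix_inv_def by (rule conjunct2)
  have "matrix_inv A = matrix_inv A ** (A ** ?B)" by (simp only: B matrix_mul_rid)
  also have "\<dots> = ?B" by (simp only: matrix_mul_assoc ex matrix_mul_lid)
  finally show ?thesis by simp
qed

lemma differential_sq_diagonal:
  assumes "\<And>i j. i \<noteq> j \<Longrightarrow> g x $ i $ j = 0" "\<And>i. g x $ i $ i \<noteq> 0"
  shows "differential_sq g \<phi> x =
    (\<Sum>i\<in>UNIV. inverse (g x $ i $ i) * (norm (frechet_derivative \<phi> (at x) (axis i 1)))\<^sup>2)"
  unfolding differential_sq_def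
  by (simp add: matrix_inv_diagonal[OF assms] mult_delta_left power2_norm_eq_inner)

lemma open_Q5_coords: "open Q5_coords"
  unfolding Q5_coords_def
  by (intro open_Collect_conj open_Collect_less continuous_intros)

lemma torus_band_eq_cbox:
  "torus_band c d = cbox (\<chi> i. if i = 5 then c else 0) (\<chi> i. if i = 5 then d else 2*pi)"
proof -
  have split: "(\<forall>i::5. P i) \<longleftrightarrow> (\<forall>i. i \<noteq> 5 \<longrightarrow> P i) \<and> P 5" for P by metis
  show ?thesis
    unfolding set_eq_iff mem_box_cart by (subst split) (simp add: torus_band_def)
qed

lemma torus_band_subset: "0 < c \<Longrightarrow> d < pi/4 \<Longrightarrow> torus_band c d \<subseteq> Q5_coords"
  by (auto simp: torus_band_def Q5_coords_def)

lemma smooth_sphere_mapD: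
  assumes "smooth_sphere_map \<phi>"
  shows "x \<in> Q5_coords \<Longrightarrow> (\<phi> has_derivative frechet_derivative \<phi> (at x)) (at x)"
    and "continuous_on Q5_coords (\<lambda>x. frechet_derivative \<phi> (at x) v)"
    and "continuous_on Q5_coords \<phi>"
    and "x \<in> Q5_coords \<Longrightarrow> norm (\<phi> x) = 1"
    and "x \<in> Q5_coords \<Longrightarrow> i \<noteq> 5 \<Longrightarrow> \<phi> (x + axis i (2*pi)) = \<phi> x"
proof -
  have C: "Ck_on 0 \<phi> Q5_coords" "Ck_on (Suc 0) \<phi> Q5_coords"
    using assms unfolding smooth_sphere_map_def smooth_on_def by blast+
  show "x \<in> Q5_coords \<Longrightarrow> (\<phi> has_derivative frechet_derivative \<phi> (at x)) (at x)"
    by (rule Ck_on_has_derivative[OF C(2)])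
  show "continuous_on Q5_coords (\<lambda>x. frechet_derivative \<phi> (at x) v)"
    using Ck_on_frechet_derivative[OF C(2)] by simp
  show "continuous_on Q5_coords \<phi>" using C(1) by simp
  show "x \<in> Q5_coords \<Longrightarrow> norm (\<phi> x) = 1"
    using assms by (auto simp: smooth_sphere_map_def)
  show "x \<in> Q5_coords \<Longrightarrow> i \<noteq> 5 \<Longrightarrow> \<phi> (x + axis i (2*pi)) = \<phi> x"
    using assms by (auto simp: smooth_sphere_map_def angle_periodic_def)
qed

lemma Q5_coords_shift: "i \<noteq> 5 \<Longrightarrow> x + axis i r \<in> Q5_coords \<longleftrightarrow> x \<in> Q5_coords"
  by (simp add: Q5_coords_def axis_def)

lemma frechet_derivative_periodic:
  assumes "smooth_sphere_map \<phi>" "x \<in> Q5_coords" "i \<noteq> 5"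
  shows "frechet_derivative \<phi> (at (x + axis i (2*pi))) = frechet_derivative \<phi> (at x)"
proof -
  let ?p = "axis i (2*pi) :: real^5"
  have shift: "((\<lambda>y. y + ?p) has_derivative (\<lambda>v. v)) (at x)"
    by (auto intro!: derivative_eq_intros)
  have "(\<phi> has_derivative frechet_derivative \<phi> (at (x + ?p))) (at (x + ?p))"
    using smooth_sphere_mapD(1)[OF assms(1)] Q5_coords_shift[OF assms(3)] assms(2) by blast
  from diff_chain_at[OF shift this]
  have "((\<lambda>y. \<phi> (y + ?p)) has_derivative frechet_derivative \<phi> (at (x + ?p))) (at x)"
    by (simp add: o_def)
  then have "(\<phi> has_derivative frechet_derivative \<phi> (at (x + ?p))) (at x)"
    by (rule has_derivative_transform_within_open[OF _ open_Q5_coords assms(2)])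
      (rule smooth_sphere_mapD(5)[OF assms(1) _ assms(3)])
  then show ?thesis by (rule frechet_derivative_at)
qed

text \<open>Here \<open>w i\<close> is the volume density times the inverse metric coefficient, and
  \<open>Z i\<close> is the \<open>i\<close>-th derivative of \<open>w i\<close> times the
  \<open>i\<close>-th partial derivative of \<open>\<phi>\<close>. The sum of the \<open>Z i\<close>
  is thus the density times the Laplace-Beltrami operator of \<open>\<phi>\<close> as a
  vector-valued function. Hypothesis \<open>tension\<close> makes it normal to the sphere, which is
  the harmonic map equation.\<close>

lemma harmonic_sphere_mapI:
  fixes g :: "real^5 \<Rightarrow> real^5^5" and \<phi> :: "real^5 \<Rightarrow> 'b::euclidean_space"
  assumes \<phi>: "smooth_sphere_map \<phi>"
    and diag: "\<And>x i j. x \<in> Q5_coords \<Longrightarrow> i \<noteq> j \<Longrightarrow> g x $ i $ j = 0"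
    and pos: "\<And>x i. x \<in> Q5_coords \<Longrightarrow> g x $ i $ i > 0"
    and w: "\<And>x i. x \<in> Q5_coords \<Longrightarrow> volume_density g x / g x $ i $ i = w i x"
    and w_cont: "\<And>i. continuous_on Q5_coords (w i)"
    and w_per: "\<And>x i j. x \<in> Q5_coords \<Longrightarrow> j \<noteq> 5 \<Longrightarrow> w i (x + axis j (2*pi)) = w i x"
    and Z: "\<And>x i. x \<in> Q5_coords \<Longrightarrow>
      ((\<lambda>\<tau>. w i (x + \<tau> *\<^sub>R axis i 1) *\<^sub>R
          frechet_derivative \<phi> (at (x + \<tau> *\<^sub>R axis i 1)) (axis i 1))
        has_vector_derivative Z i x) (at 0)"
    and Z_cont: "\<And>i. continuous_on Q5_coords (Z i)"
    and tension: "\<And>x. x \<in> Q5_coords \<Longrightarrow> (\<Sum>i\<in>UNIV. Z i x) = - \<mu> x *\<^sub>R \<phi> x"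
    and \<mu>_cont: "continuous_on Q5_coords \<mu>"
  shows "harmonic_sphere_map g \<phi>"
  unfolding harmonic_sphere_map_def
proof (intro conjI allI impI \<phi>)
  fix \<epsilon> c d :: real and \<Phi> :: "real \<Rightarrow> real^5 \<Rightarrow> 'b"
  assume "0 < \<epsilon> \<and> 0 < c \<and> c < d \<and> d < pi/4 \<and> compact_variation \<phi> \<epsilon> c d \<Phi>"
  then have ecd: "0 < \<epsilon>" "0 < c" "c < d" "d < pi/4"
    and var: "compact_variation \<phi> \<epsilon> c d \<Phi>" by auto
  let ?K = "torus_band c d" and ?e = "\<lambda>i. axis i 1 :: real^5"
  let ?\<Phi> = "\<lambda>(t, x). \<Phi> t x"
  let ?d\<phi> = "\<lambda>i x. frechet_derivative \<phi> (at x) (?e i)"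
  \<comment> \<open>The spatial derivatives are read off from the joint map in
    \<open>(t, x)\<close>, so that they are known to be smooth in both arguments together.\<close>
  define G where "G i p = frechet_derivative ?\<Phi> (at p) (0, ?e i)" for i p
  have K: "?K \<subseteq> Q5_coords" "compact ?K"
    using torus_band_subset ecd by (auto simp: torus_band_eq_cbox)
  note onK = continuous_on_subset[OF _ K(1)]
  have S\<Phi>: "smooth_sphere_map (\<Phi> t)" if "\<bar>t\<bar> < \<epsilon>" for t
    using var that by (auto simp: compact_variation_def abs_less_iff)
  have \<Phi>0: "\<Phi> 0 x = \<phi> x" if "x \<in> Q5_coords" for x
    using var that by (auto simp: compact_variation_def)
  have out: "\<Phi> t x = \<phi> x" if "\<bar>t\<bar> < \<epsilon>" "x \<in> Q5_coords" "x $ 5 \<notin> {c..d}" for t x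
    using var that unfolding compact_variation_def by (auto simp: abs_less_iff)
  have smooth: "Ck_on k ?\<Phi> ({-\<epsilon><..<\<epsilon>} \<times> Q5_coords)" for k
    using var by (simp only: compact_variation_def smooth_on_def)
  have G: "frechet_derivative (\<Phi> t) (at x) (?e i) = G i (t, x)"
    if "\<bar>t\<bar> < \<epsilon>" "x \<in> Q5_coords" for t x i
  proof -
    have D: "(?\<Phi> has_derivative frechet_derivative ?\<Phi> (at (t, x))) (at (t, x))"
      by (rule Ck_on_has_derivative[OF smooth]) (use that in auto)
    have "((\<lambda>x. (t, x)) has_derivative (\<lambda>v. (0, v))) (at x)"
      by (auto intro!: derivative_eq_intros)
    from diff_chain_at[OF this D]
    have "(\<Phi> t has_derivative (\<lambda>v. frechet_derivative ?\<Phi> (at (t, x)) (0, v))) (at x)"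
      by (simp add: o_def)
    from frechet_derivative_at[OF this, symmetric] show ?thesis by (simp add: G_def)
  qed
  have G0: "G i (0, x) = ?d\<phi> i x" if "x \<in> Q5_coords" for i x
    using G[of 0 x i] frechet_derivative_cong_open[OF open_Q5_coords that \<Phi>0] ecd that by simp
  have G_cont: "continuous_on ?K (\<lambda>x. G i (t, x))" if "\<bar>t\<bar> < \<epsilon>" for t i
    using onK[OF smooth_sphere_mapD(2)[OF S\<Phi>[OF that], of "?e i"]] G[OF that] K(1)
    by (subst continuous_on_cong[OF refl]) auto
  have \<Phi>_cont: "continuous_on ?K (\<Phi> t)" if "\<bar>t\<bar> < \<epsilon>" for t
    by (rule onK[OF smooth_sphere_mapD(3)[OF S\<Phi>[OF that]]])
  note conts = onK[OF w_cont] onK[OF Z_cont] onK[OF \<mu>_cont] onK[OF smooth_sphere_mapD(2)[OF \<phi>]]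
    onK[OF smooth_sphere_mapD(3)[OF \<phi>]] G_cont \<Phi>_cont
  have integrable: "f integrable_on ?K" if "continuous_on ?K f" for f :: "real^5 \<Rightarrow> real"
    using that unfolding torus_band_eq_cbox by (rule integrable_continuous)

  have energy_eq: "energy g c d (\<Phi> t) = 1/2 * integral ?K (\<lambda>x. \<Sum>i\<in>UNIV. w i x * (norm (G i (t, x)))\<^sup>2)"
    if "\<bar>t\<bar> < \<epsilon>" for t
  proof -
    have "differential_sq g (\<Phi> t) x * volume_density g x = (\<Sum>i\<in>UNIV. w i x * (norm (G i (t, x)))\<^sup>2)"
      if "x \<in> ?K" for x
    proof -
      have x: "x \<in> Q5_coords" using that K(1) by blast
      have "g x $ i $ i \<noteq> 0" for i using pos[OF x, of i] by simp
      then show ?thesis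
        by (simp add: differential_sq_diagonal[of g x] diag[OF x] G[OF \<open>\<bar>t\<bar> < \<epsilon>\<close> x] sum_distrib_left
            w[OF x, symmetric] divide_inverse mult_ac)
    qed
    then have "integral ?K (\<lambda>x. differential_sq g (\<Phi> t) x * volume_density g x)
        = integral ?K (\<lambda>x. \<Sum>i\<in>UNIV. w i x * (norm (G i (t, x)))\<^sup>2)"
      by (rule integral_cong)
    then show ?thesis by (simp add: energy_def)
  qed

  \<comment> \<open>This is the part of the energy difference that survives integration; it is
    quadratic in the variation and its first derivatives.\<close>
  define R where "R t x = (\<Sum>i\<in>UNIV. w i x * (norm (G i (t, x) - ?d\<phi> i x))\<^sup>2)
      - \<mu> x * (norm (\<Phi> t x - \<phi> x))\<^sup>2" for t x
  have R_cont: "continuous_on ?K (R t)" if "\<bar>t\<bar> < \<epsilon>" for t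
    unfolding R_def by (intro continuous_intros conts that)

  have energy_diff: "energy g c d (\<Phi> t) - energy g c d (\<Phi> 0) = 1/2 * integral ?K (R t)"
    if t: "\<bar>t\<bar> < \<epsilon>" for t
  proof -
    let ?\<psi> = "\<lambda>x. \<Phi> t x - \<phi> x" and ?D = "\<lambda>i x. G i (t, x) - ?d\<phi> i x"
    let ?F = "\<lambda>i x. (w i x *\<^sub>R ?d\<phi> i x) \<bullet> ?\<psi> x"
    let ?F' = "\<lambda>i x. w i x * (?d\<phi> i x \<bullet> ?D i x) + Z i x \<bullet> ?\<psi> x"
    have F'_cont: "continuous_on ?K (?F' i)" for i
      by (intro continuous_intros conts t)
    \<comment> \<open>The variation is trivial where the last coordinate lies outside
      \<open>{c..d}\<close>. A point with last coordinate \<open>c\<close> or \<open>d\<close> is a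
      limit of such points, approached in direction \<open>s = -1\<close> or \<open>s = 1\<close>
      respectively, and continuity gives the value there.\<close>
    have \<psi>_edge: "?\<psi> x = 0" if x: "x \<in> Q5_coords" "x $ 5 = c \<or> x $ 5 = d" for x
    proof -
      have "\<exists>s::real. \<forall>\<tau>>0. (x + (\<tau> * s) *\<^sub>R axis 5 1) $ 5 \<notin> {c..d}"
      proof (cases "x $ 5 = c")
        case True
        then show ?thesis by (intro exI[of _ "-1"]) (auto simp: axis_def)
      next
        case False
        with x show ?thesis by (intro exI[of _ 1]) (auto simp: axis_def)
      qed
      then obtain s :: real where s: "\<And>\<tau>. \<tau> > 0 \<Longrightarrow> (x + (\<tau> * s) *\<^sub>R axis 5 1) $ 5 \<notin> {c..d}"
        by blast
      have lim: "((\<lambda>\<tau>. x + (\<tau> * s) *\<^sub>R axis 5 1) \<longlongrightarrow> x) (at_right 0)"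
        by (auto intro!: tendsto_eq_intros)
      have "continuous_on Q5_coords ?\<psi>"
        by (intro continuous_intros smooth_sphere_mapD(3) S\<Phi> t \<phi>)
      then have "isCont ?\<psi> x"
        using continuous_on_eq_continuous_at[OF open_Q5_coords] x(1) by blast
      from isCont_tendsto_compose[OF this lim]
      have "((\<lambda>\<tau>. ?\<psi> (x + (\<tau> * s) *\<^sub>R axis 5 1)) \<longlongrightarrow> ?\<psi> x) (at_right 0)" .
      moreover have "eventually (\<lambda>\<tau>. ?\<psi> (x + (\<tau> * s) *\<^sub>R axis 5 1) = 0) (at_right 0)"
        using topological_tendstoD[OF lim open_Q5_coords x(1)] eventually_at_right_less[of 0]
        by eventually_elim (use out[OF t] s in auto)
      then have "((\<lambda>\<tau>. ?\<psi> (x + (\<tau> * s) *\<^sub>R axis 5 1)) \<longlongrightarrow> 0) (at_right 0)"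
        by (rule tendsto_eventually)
      ultimately show ?thesis
        using tendsto_unique[OF trivial_limit_at_right_real] by blast
    qed
    \<comment> \<open>\<open>?F' i\<close> is the derivative of \<open>?F i\<close> in direction
      \<open>i\<close>. Opposite faces in an angular direction are identified by periodicity; in the
      last direction \<open>?F i\<close> vanishes on both faces by
      \<open>\<psi>_edge\<close>.\<close>
    have F'_zero: "integral ?K (?F' i) = 0" for i
      unfolding torus_band_eq_cbox
    proof (rule integral_cbox_directional_derivative_zero[where i = "?e i" and F = "?F i"])
      show "axis i 1 \<in> (Basis :: (real^5) set)" by simp
      show "continuous_on (cbox (\<chi> i. if i = 5 then c else 0) (\<chi> i. if i = 5 then d else 2*pi)) (?F' i)"
        using F'_cont[of i] unfolding torus_band_eq_cbox .
    next
      fix x :: "real^5"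
      assume "x \<in> cbox (\<chi> i. if i = 5 then c else 0) (\<chi> i. if i = 5 then d else 2*pi)"
      then have xK: "x \<in> ?K" by (simp only: torus_band_eq_cbox)
      then have x: "x \<in> Q5_coords" using K(1) by blast
      have along: "((\<lambda>\<tau>. f (x + \<tau> *\<^sub>R ?e i)) has_vector_derivative frechet_derivative f (at x) (?e i)) (at 0)"
        if "smooth_sphere_map f" for f :: "real^5 \<Rightarrow> 'b"
      proof -
        have "((\<lambda>\<tau>. x + \<tau> *\<^sub>R ?e i) has_derivative (\<lambda>\<tau>. \<tau> *\<^sub>R ?e i)) (at 0)"
          by (auto intro!: derivative_eq_intros)
        moreover have "(f has_derivative frechet_derivative f (at x)) (at (x + 0 *\<^sub>R ?e i))"
          using smooth_sphere_mapD(1)[OF that x] by simp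
        ultimately have "((\<lambda>\<tau>. f (x + \<tau> *\<^sub>R ?e i)) has_derivative
            (\<lambda>\<tau>. frechet_derivative f (at x) (\<tau> *\<^sub>R ?e i))) (at 0)"
          using diff_chain_at by (fastforce simp: o_def)
        then show ?thesis
          using linear_cmul[OF has_derivative_linear[OF smooth_sphere_mapD(1)[OF that x]]]
          by (simp add: has_vector_derivative_def)
      qed
      have "((\<lambda>\<tau>. ?\<psi> (x + \<tau> *\<^sub>R ?e i)) has_vector_derivative ?D i x) (at 0)"
        using has_vector_derivative_diff[OF along[OF S\<Phi>[OF t]] along[OF \<phi>]] G[OF t x] by simp
      from bounded_bilinear.has_vector_derivative[OF bounded_bilinear_inner Z[OF x] this]
      show "((\<lambda>\<tau>. ?F i (x + \<tau> *\<^sub>R ?e i)) has_real_derivative ?F' i x) (at 0)"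
        by (simp add: has_real_derivative_iff_has_vector_derivative)
      assume "x \<bullet> ?e i = (\<chi> i. if i = 5 then c else 0) \<bullet> ?e i"
      then have xi: "x $ i = (if i = 5 then c else 0)" by (simp add: inner_axis)
      have shift: "x + ((\<chi> i. if i = 5 then d else 2*pi) \<bullet> ?e i - (\<chi> i. if i = 5 then c else 0) \<bullet> ?e i) *\<^sub>R ?e i
          = (if i = 5 then x + axis 5 (d - c) else x + axis i (2*pi))" (is "?y = _")
        by (simp add: inner_axis) (auto simp: vec_eq_iff axis_def)
      show "?F i ?y = ?F i x"
      proof (cases "i = 5")
        case True
        have "(x + axis 5 (d - c)) $ 5 = d" using xi True by (simp add: axis_def)
        moreover from this have "x + axis 5 (d - c) \<in> Q5_coords"
          using ecd by (simp add: Q5_coords_def)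
        ultimately have "?\<psi> ?y = 0" "?\<psi> x = 0"
          using \<psi>_edge[of x] \<psi>_edge[of "x + axis 5 (d - c)"] xi x True unfolding shift by auto
        then show ?thesis by simp
      next
        case False
        have "?y = x + axis i (2*pi)" using shift False by simp
        then show ?thesis
          using w_per[OF x False, of i] smooth_sphere_mapD(5)[OF \<phi> x False]
            smooth_sphere_mapD(5)[OF S\<Phi>[OF t] x False] frechet_derivative_periodic[OF \<phi> x False]
          by simp
      qed
    qed
    \<comment> \<open>Expanding the square leaves a cross term
      \<open>w i x * (?d\<phi> i x \<bullet> ?D i x)\<close>. Adding
      \<open>Z i x \<bullet> ?\<psi> x\<close> completes it to \<open>?F' i x\<close>; by
      \<open>tension\<close> and the unit length of both maps this costs exactly the
      \<open>\<mu>\<close> term of \<open>R\<close>.\<close>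
    have pointwise: "(\<Sum>i\<in>UNIV. w i x * (norm (G i (t, x)))\<^sup>2)
        = (\<Sum>i\<in>UNIV. w i x * (norm (G i (0, x)))\<^sup>2) + (R t x + 2 * (\<Sum>i\<in>UNIV. ?F' i x))"
      if "x \<in> ?K" for x
    proof -
      have x: "x \<in> Q5_coords" using that K(1) by blast
      have "norm (\<Phi> t x) = 1" "norm (\<phi> x) = 1"
        using smooth_sphere_mapD(4) S\<Phi>[OF t] \<phi> x by blast+
      then have "\<phi> x \<bullet> ?\<psi> x = - (norm (?\<psi> x))\<^sup>2 / 2"
        by (simp add: power2_norm_eq_inner norm_eq_1 algebra_simps inner_commute)
      moreover have "(\<Sum>i\<in>UNIV. Z i x \<bullet> ?\<psi> x) = (- \<mu> x *\<^sub>R \<phi> x) \<bullet> ?\<psi> x"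
        by (simp only: inner_sum_left[symmetric] tension[OF x])
      ultimately have "2 * (\<Sum>i\<in>UNIV. Z i x \<bullet> ?\<psi> x) = \<mu> x * (norm (?\<psi> x))\<^sup>2" by simp
      moreover have "w i x * (norm (G i (t, x)))\<^sup>2 = w i x * (norm (G i (0, x)))\<^sup>2
          + w i x * (norm (?D i x))\<^sup>2 + 2 * (w i x * (?d\<phi> i x \<bullet> ?D i x))" for i
        unfolding G0[OF x] by (simp add: power2_norm_eq_inner algebra_simps inner_commute)
      then have "(\<Sum>i\<in>UNIV. w i x * (norm (G i (t, x)))\<^sup>2) = (\<Sum>i\<in>UNIV. w i x * (norm (G i (0, x)))\<^sup>2)
          + (\<Sum>i\<in>UNIV. w i x * (norm (?D i x))\<^sup>2) + 2 * (\<Sum>i\<in>UNIV. w i x * (?d\<phi> i x \<bullet> ?D i x))"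
        by (simp only: sum.distrib sum_distrib_left)
      ultimately show ?thesis by (simp add: R_def sum.distrib)
    qed
    have "integral ?K (\<lambda>x. \<Sum>i\<in>UNIV. w i x * (norm (G i (t, x)))\<^sup>2)
        = integral ?K (\<lambda>x. (\<Sum>i\<in>UNIV. w i x * (norm (G i (0, x)))\<^sup>2) + (R t x + 2 * (\<Sum>i\<in>UNIV. ?F' i x)))"
      by (rule integral_cong) (rule pointwise)
    also have "\<dots> = integral ?K (\<lambda>x. \<Sum>i\<in>UNIV. w i x * (norm (G i (0, x)))\<^sup>2)
        + (integral ?K (R t) + 2 * (\<Sum>i\<in>UNIV. integral ?K (?F' i)))"
    proof -
      have i1: "(\<lambda>x. \<Sum>i\<in>UNIV. w i x * (norm (G i (0, x)))\<^sup>2) integrable_on ?K"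
        using ecd by (intro integrable continuous_intros conts) auto
      have i2: "R t integrable_on ?K" by (intro integrable R_cont t)
      have i3: "?F' i integrable_on ?K" for i by (intro integrable F'_cont)
      have i4: "(\<lambda>x. \<Sum>i\<in>UNIV. ?F' i x) integrable_on ?K" by (intro integrable_sum i3) simp
      have i5: "(\<lambda>x. 2 * (\<Sum>i\<in>UNIV. ?F' i x)) integrable_on ?K"
        using integrable_on_cmult_left[OF i4, of 2] by simp
      show ?thesis
        by (subst integral_add[OF i1 integrable_add[OF i2 i5]], subst integral_add[OF i2 i5],
            subst integral_mult_right, subst integral_sum) (auto intro: i3)
    qed
    finally have "integral ?K (\<lambda>x. \<Sum>i\<in>UNIV. w i x * (norm (G i (t, x)))\<^sup>2)
        = integral ?K (\<lambda>x. \<Sum>i\<in>UNIV. w i x * (norm (G i (0, x)))\<^sup>2) + integral ?K (R t)"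
      by (simp only: F'_zero sum.neutral_const mult_zero_right add_0_right)
    moreover have "\<bar>0\<bar> < \<epsilon>" using ecd by simp
    ultimately show ?thesis
      by (simp only: energy_eq[OF t] energy_eq right_diff_distrib[symmetric] add_diff_cancel_left')
  qed

  obtain C0 where C0: "0 \<le> C0"
    "\<And>t x. \<bar>t\<bar> \<le> \<epsilon>/2 \<Longrightarrow> x \<in> ?K \<Longrightarrow> norm (\<Phi> t x - \<phi> x) \<le> C0 * \<bar>t\<bar>"
  proof (rule Ck_on_lipschitz_in_parameter[OF smooth K(2,1) ecd(1)])
    fix C assume "0 \<le> C" and C: "\<And>t x. \<bar>t\<bar> \<le> \<epsilon>/2 \<Longrightarrow> x \<in> ?K \<Longrightarrow> norm (?\<Phi> (t, x) - ?\<Phi> (0, x)) \<le> C * \<bar>t\<bar>"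
    have "norm (\<Phi> t x - \<phi> x) \<le> C * \<bar>t\<bar>" if "\<bar>t\<bar> \<le> \<epsilon>/2" "x \<in> ?K" for t x
      using C[OF that] \<Phi>0 K(1) that by auto
    with \<open>0 \<le> C\<close> show thesis by (rule that)
  qed
  have "\<exists>C\<ge>0. \<forall>t x. \<bar>t\<bar> \<le> \<epsilon>/2 \<longrightarrow> x \<in> ?K \<longrightarrow> norm (G i (t, x) - ?d\<phi> i x) \<le> C * \<bar>t\<bar>" for i
  proof (rule Ck_on_lipschitz_in_parameter[OF _ K(2,1) ecd(1)])
    show "Ck_on (Suc 0) (G i) ({-\<epsilon><..<\<epsilon>} \<times> Q5_coords)"
      unfolding G_def by (rule Ck_on_frechet_derivative[OF smooth])
    fix C assume "0 \<le> C" and C: "\<And>t x. \<bar>t\<bar> \<le> \<epsilon>/2 \<Longrightarrow> x \<in> ?K \<Longrightarrow> norm (G i (t, x) - G i (0, x)) \<le> C * \<bar>t\<bar>"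
    have "norm (G i (t, x) - ?d\<phi> i x) \<le> C * \<bar>t\<bar>" if "\<bar>t\<bar> \<le> \<epsilon>/2" "x \<in> ?K" for t x
      using C[OF that] G0 K(1) that by auto
    with \<open>0 \<le> C\<close> show ?thesis by blast
  qed
  then obtain C where C: "\<And>i. 0 \<le> C i"
    "\<And>i t x. \<bar>t\<bar> \<le> \<epsilon>/2 \<Longrightarrow> x \<in> ?K \<Longrightarrow> norm (G i (t, x) - ?d\<phi> i x) \<le> C i * \<bar>t\<bar>"
    by metis
  have bounded: "\<exists>B\<ge>0. \<forall>x\<in>?K. \<bar>f x\<bar> \<le> B" if "continuous_on ?K f" for f :: "real^5 \<Rightarrow> real"
    using compact_imp_bounded[OF compact_continuous_image[OF that K(2)]]
    unfolding bounded_pos by (auto intro: less_imp_le)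
  have "\<exists>B\<ge>0. \<forall>x\<in>?K. \<bar>w i x\<bar> \<le> B" for i by (intro bounded conts)
  then obtain W where W: "\<And>i. 0 \<le> W i" "\<And>i x. x \<in> ?K \<Longrightarrow> \<bar>w i x\<bar> \<le> W i" by metis
  obtain L where L: "0 \<le> L" "\<And>x. x \<in> ?K \<Longrightarrow> \<bar>\<mu> x\<bar> \<le> L"
    using bounded[OF conts(3)] by blast
  \<comment> \<open>On the compact band the coefficients are bounded by \<open>W i\<close> and
    \<open>L\<close>, and the differences by \<open>C i\<close> and \<open>C0\<close> times
    \<open>\<bar>t\<bar>\<close>. Hence \<open>R\<close> is bounded by
    \<open>M * t\<^sup>2\<close>.\<close>
  define M where "M = (\<Sum>i\<in>UNIV. W i * (C i)\<^sup>2) + L * C0\<^sup>2"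
  have M: "0 \<le> M" unfolding M_def using W(1) L(1) by (intro add_nonneg_nonneg sum_nonneg mult_nonneg_nonneg) auto
  have term_le: "\<bar>a * (norm v)\<^sup>2\<bar> \<le> A * B\<^sup>2 * t\<^sup>2"
    if "\<bar>a\<bar> \<le> A" "norm v \<le> B * \<bar>t\<bar>" for a A B t :: real and v :: 'b
  proof -
    have "(norm v)\<^sup>2 \<le> (B * \<bar>t\<bar>)\<^sup>2" using that(2) by (intro power_mono) auto
    then have "\<bar>a\<bar> * (norm v)\<^sup>2 \<le> A * (B * \<bar>t\<bar>)\<^sup>2" using that(1) by (intro mult_mono) auto
    then show ?thesis by (simp add: abs_mult power_mult_distrib)
  qed
  have R_le: "\<bar>R t x\<bar> \<le> M * t\<^sup>2" if "\<bar>t\<bar> \<le> \<epsilon>/2" "x \<in> ?K" for t x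
  proof -
    have "\<bar>R t x\<bar> \<le> \<bar>\<Sum>i\<in>UNIV. w i x * (norm (G i (t, x) - ?d\<phi> i x))\<^sup>2\<bar> + \<bar>\<mu> x * (norm (\<Phi> t x - \<phi> x))\<^sup>2\<bar>"
      unfolding R_def by (rule abs_triangle_ineq4)
    also have "\<dots> \<le> (\<Sum>i\<in>UNIV. \<bar>w i x * (norm (G i (t, x) - ?d\<phi> i x))\<^sup>2\<bar>) + \<bar>\<mu> x * (norm (\<Phi> t x - \<phi> x))\<^sup>2\<bar>"
      by (intro add_right_mono sum_abs)
    also have "\<dots> \<le> (\<Sum>i\<in>UNIV. W i * (C i)\<^sup>2 * t\<^sup>2) + L * C0\<^sup>2 * t\<^sup>2"
      by (intro add_mono sum_mono term_le W L C C0 that)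
    also have "\<dots> = M * t\<^sup>2" by (simp add: M_def sum_distrib_right distrib_right)
    finally show ?thesis .
  qed
  let ?vol = "measure lborel (cbox (\<chi> i. if i = 5 then c else 0) (\<chi> i. if i = 5 then d else 2*pi) :: (real^5) set)"
  show "((\<lambda>t. energy g c d (\<Phi> t)) has_real_derivative 0) (at 0)"
  proof (rule has_real_derivative_zero_if_quadratic[of "\<epsilon>/2" _ "M * ?vol"])
    fix t assume t: "\<bar>t\<bar> \<le> \<epsilon>/2"
    then have t': "\<bar>t\<bar> < \<epsilon>" using ecd by linarith
    have "(R t has_integral integral ?K (R t)) ?K"
      by (intro integrable_integral integrable R_cont t')
    then have "norm (integral ?K (R t)) \<le> M * t\<^sup>2 * ?vol"
      unfolding torus_band_eq_cbox
      by (rule has_integral_bound[rotated]) (use M R_le[OF t] in \<open>auto simp: torus_band_eq_cbox\<close>)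
    moreover have "\<bar>energy g c d (\<Phi> t) - energy g c d (\<Phi> 0)\<bar> = norm (integral ?K (R t)) / 2"
      unfolding energy_diff[OF t'] by simp
    moreover have "0 \<le> M * t\<^sup>2 * ?vol" using M by simp
    ultimately show "\<bar>energy g c d (\<Phi> t) - energy g c d (\<Phi> 0)\<bar> \<le> M * ?vol * t\<^sup>2"
      by (simp add: mult_ac)
  qed (use ecd in simp)
qed

section \<open>The metric and the profile function\<close>

locale Q5_setting =
  fixes k1 k2 k3 k4 :: int and a1 a2 a3 a4 :: real
  assumes a_pos: "a1 > 0" "a2 > 0" "a3 > 0" "a4 > 0"
    and a_eq: "a1 = \<bar>of_int k1\<bar>" "a2 = \<bar>of_int k2\<bar>" "a3 = \<bar>of_int k3\<bar>" "a4 = \<bar>of_int k4\<bar>"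
begin

abbreviation "h \<equiv> h_fun a1 a2 a3 a4"
abbreviation "g \<equiv> Q5_metric a1 a2 a3 a4"

definition gd :: "real \<Rightarrow> 5 \<Rightarrow> real" where
  "gd s i =
    (if i = 1 then a1\<^sup>2 * (sin s)\<^sup>2
     else if i = 2 then a2\<^sup>2 * (sin (s + pi/4))\<^sup>2
     else if i = 3 then a3\<^sup>2 * (cos s)\<^sup>2
     else if i = 4 then a4\<^sup>2 * (cos (s + pi/4))\<^sup>2
     else (h s)\<^sup>2)"

text \<open>The value 0 at the index of the coordinate \<open>s\<close> lets sums over the angles
  run over all five indices.\<close>

definition \<kappa> :: "5 \<Rightarrow> real" where
  "\<kappa> i = (if i = 1 then of_int k1 else if i = 2 then of_int k2 else if i = 3 then of_int k3
     else if i = 4 then of_int k4 else 0)"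

text \<open>The phase of the map. It is linear, hence its own derivative: applied to a tangent
  vector it is the differential of the phase.\<close>

definition \<Theta> :: "real^5 \<Rightarrow> real" where
  "\<Theta> x = of_int k1 * x$1 + of_int k2 * x$2 + of_int k3 * x$3 + of_int k4 * x$4"

lemma g_nth: "g x $ i $ j = (if i = j then gd (x$5) i else 0)"
  by (simp add: Q5_metric_def gd_def Let_def)

lemma \<kappa>_5 [simp]: "\<kappa> 5 = 0"
  by (simp add: \<kappa>_def)

lemma \<Theta>_eq_sum: "\<Theta> x = (\<Sum>i\<in>UNIV. \<kappa> i * x $ i)"
  by (simp add: \<Theta>_def \<kappa>_def sum_5)

lemma \<kappa>_nonzero: "\<kappa> 1 \<noteq> 0" "\<kappa> 2 \<noteq> 0" "\<kappa> 3 \<noteq> 0" "\<kappa> 4 \<noteq> 0"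
  using a_pos a_eq by (auto simp: \<kappa>_def)

lemma \<kappa>_sq: "a1\<^sup>2 = (\<kappa> 1)\<^sup>2" "a2\<^sup>2 = (\<kappa> 2)\<^sup>2" "a3\<^sup>2 = (\<kappa> 3)\<^sup>2" "a4\<^sup>2 = (\<kappa> 4)\<^sup>2"
  by (simp_all add: a_eq \<kappa>_def)

lemma bounded_linear_\<Theta>: "bounded_linear \<Theta>"
  unfolding \<Theta>_def
  by (intro bounded_linear_add bounded_linear_const_mult bounded_linear_vec_nth)

lemma trig_pos:
  assumes "s \<in> {0<..<pi/4}"
  shows "sin s > 0" "cos s > 0" "sin (s + pi/4) > 0" "cos (s + pi/4) > 0"
    "sin (2 * s) > 0" "cos (2 * s) > 0" "sin (4 * s) > 0"
proof -
  have "0 < s" "s < pi/4" using assms by auto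
  then show "sin s > 0" "cos s > 0" "sin (s + pi/4) > 0" "cos (s + pi/4) > 0"
    "sin (2 * s) > 0" "cos (2 * s) > 0" "sin (4 * s) > 0"
    by (auto intro!: sin_gt_zero cos_gt_zero)
qed

text \<open>The terms with \<open>a1\<close> and \<open>a3\<close> alone dominate the squared
  minimum, since their trigonometric weights add up to 1. The positive bound, uniform in
  \<open>s\<close>, is what makes the antiderivative of \<open>4 * h s / sin (4 * s)\<close> diverge
  at both ends.\<close>

lemma h_ge: "h s \<ge> min a1 a3"
proof -
  let ?m = "min a1 a3"
  have m: "?m\<^sup>2 \<le> a1\<^sup>2" "?m\<^sup>2 \<le> a3\<^sup>2" using a_pos by (auto intro!: power_mono)
  have "?m\<^sup>2 = ?m\<^sup>2 * (cos s)\<^sup>2 + ?m\<^sup>2 * (sin s)\<^sup>2"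
    by (simp add: distrib_left[symmetric])
  also have "\<dots> \<le> a1\<^sup>2 * (cos s)\<^sup>2 + a3\<^sup>2 * (sin s)\<^sup>2"
    by (intro add_mono mult_right_mono m) auto
  also have "\<dots> \<le> a1\<^sup>2 * (cos s)\<^sup>2 + a2\<^sup>2 * (cos (s + pi/4))\<^sup>2 + a3\<^sup>2 * (sin s)\<^sup>2 + a4\<^sup>2 * (sin (s + pi/4))\<^sup>2"
    by simp
  finally show ?thesis
    unfolding h_fun_def by (rule real_le_rsqrt)
qed

lemma h_pos: "h s > 0"
  using h_ge[of s] a_pos by (simp add: min_def split: if_splits)

lemma gd_pos: "s \<in> {0<..<pi/4} \<Longrightarrow> gd s i > 0"
  using trig_pos[of s] h_pos[of s] a_pos by (auto simp: gd_def)

lemma isCont_h: "isCont h s"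
  unfolding h_fun_def by (intro continuous_intros)

lemma smooth_on_h: "open S \<Longrightarrow> smooth_on S h"
proof -
  assume S: "open S"
  have pos: "a1\<^sup>2 * (cos s)\<^sup>2 + a2\<^sup>2 * (cos (s + pi/4))\<^sup>2 + a3\<^sup>2 * (sin s)\<^sup>2 + a4\<^sup>2 * (sin (s + pi/4))\<^sup>2 > 0" for s
    using h_pos[of s] unfolding h_fun_def by simp
  show ?thesis
    unfolding h_fun_def
    by (rule smooth_on_sqrt[OF S _ pos], unfold power2_eq_square)
      (intro smooth_on_add smooth_on_mult smooth_on_const smooth_on_sin smooth_on_cos
        smooth_on_linear bounded_linear_ident S)
qed

text \<open>The integers cancel against the \<open>a_i\<close>. The identity \<open>inv\<close>
  merges the terms at \<open>s\<close> and those at \<open>s + pi/4\<close>; as the doubled angles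
  differ by a quarter turn, it then applies once more at \<open>2 * s\<close>.\<close>

lemma sum_\<kappa>_sq_over_gd:
  assumes "s \<in> {0<..<pi/4}"
  shows "(\<Sum>i\<in>UNIV. (\<kappa> i)\<^sup>2 / gd s i) = 16 / (sin (4 * s))\<^sup>2"
proof -
  note pos = trig_pos[OF assms]
  have inv: "1 / (sin t)\<^sup>2 + 1 / (cos t)\<^sup>2 = 4 / (sin (2*t))\<^sup>2" if "sin t \<noteq> 0" "cos t \<noteq> 0" for t :: real
  proof -
    have "1 / x + 1 / y = (x + y) / (x * y)" if "x \<noteq> 0" "y \<noteq> 0" for x y :: real
      using that by (simp add: field_simps)
    from this[of "(sin t)\<^sup>2" "(cos t)\<^sup>2"]
    have "1 / (sin t)\<^sup>2 + 1 / (cos t)\<^sup>2 = ((sin t)\<^sup>2 + (cos t)\<^sup>2) / ((sin t)\<^sup>2 * (cos t)\<^sup>2)"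
      using that by simp
    then show ?thesis
      unfolding sin_double by (simp add: power_mult_distrib)
  qed
  have "(\<Sum>i\<in>UNIV. (\<kappa> i)\<^sup>2 / gd s i) = (1 / (sin s)\<^sup>2 + 1 / (cos s)\<^sup>2)
      + (1 / (sin (s + pi/4))\<^sup>2 + 1 / (cos (s + pi/4))\<^sup>2)"
    using \<kappa>_nonzero pos by (simp add: sum_5 gd_def \<kappa>_sq)
  also have "\<dots> = 4 / (sin (2 * s))\<^sup>2 + 4 / (sin (2 * (s + pi/4)))\<^sup>2"
    using pos by (simp add: inv)
  also have "2 * (s + pi/4) = 2 * s + pi/2" by simp
  also have "4 / (sin (2 * s))\<^sup>2 + 4 / (sin (2 * s + pi/2))\<^sup>2
      = 4 * (1 / (sin (2 * s))\<^sup>2 + 1 / (cos (2 * s))\<^sup>2)"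
    by (simp add: sin_add)
  also have "\<dots> = 16 / (sin (2 * (2 * s)))\<^sup>2"
    using pos by (subst inv) auto
  finally show ?thesis by simp
qed

text \<open>The determinant is a perfect square whose root is positive on the open interval. Its
  four trigonometric factors collapse through the double angle formula, applied at \<open>s\<close>,
  at \<open>s + pi/4\<close> and at \<open>2 * s\<close>.\<close>

lemma volume_density_g:
  assumes "x \<in> Q5_coords"
  shows "volume_density g x = a1 * a2 * a3 * a4 * h (x$5) * sin (4 * x$5) / 8"
proof -
  let ?s = "x$5"
  have s: "?s \<in> {0<..<pi/4}" using assms by (simp add: Q5_coords_def)
  note pos = trig_pos[OF s]
  have "det (g x) = (\<Prod>i\<in>UNIV. gd ?s i)"
    by (subst det_diagonal) (auto simp: g_nth)
  also have "\<dots> = (a1 * a2 * a3 * a4 * h ?s * (sin ?s * cos ?s) * (sin (?s + pi/4) * cos (?s + pi/4)))\<^sup>2"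
    unfolding UNIV_5 by (simp add: gd_def power_mult_distrib)
  finally have "volume_density g x
      = a1 * a2 * a3 * a4 * h ?s * (sin ?s * cos ?s) * (sin (?s + pi/4) * cos (?s + pi/4))"
    using pos a_pos h_pos[of ?s] by (simp add: volume_density_def)
  also have "sin ?s * cos ?s = sin (2 * ?s) / 2" by (simp add: sin_double)
  also have "sin (?s + pi/4) * cos (?s + pi/4) = sin (2 * (?s + pi/4)) / 2" unfolding sin_double by simp
  also have "2 * (?s + pi/4) = 2 * ?s + pi/2" by simp
  also have "sin (2 * ?s + pi/2) = cos (2 * ?s)" by (simp add: sin_add)
  also have "a1 * a2 * a3 * a4 * h ?s * (sin (2 * ?s) / 2) * (cos (2 * ?s) / 2)
      = a1 * a2 * a3 * a4 * h ?s * (2 * sin (2 * ?s) * cos (2 * ?s)) / 8" by simp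
  also have "2 * sin (2 * ?s) * cos (2 * ?s) = sin (2 * (2 * ?s))" by (simp only: sin_double)
  finally show ?thesis by simp
qed

text \<open>The equation is separable: the logarithm of \<open>tan (\<alpha> / 2)\<close> has
  derivative \<open>?b\<close>. The values at the two end points are fixed as well, since the
  extension to the closure evaluates \<open>\<alpha>\<close> there.\<close>

lemma alpha_exists:
  obtains \<alpha> :: "real \<Rightarrow> real" where
    "\<And>s. s \<in> {0<..<pi/4} \<Longrightarrow> (\<alpha> has_real_derivative 4 * h s * sin (\<alpha> s) / sin (4 * s)) (at s)"
    "smooth_on {0<..<pi/4} \<alpha>"
    "\<And>s. s \<in> {0<..<pi/4} \<Longrightarrow> \<alpha> s \<in> {0<..<pi}"
    "(\<alpha> \<longlongrightarrow> 0) (at_right 0)" "(\<alpha> \<longlongrightarrow> pi) (at_left (pi/4))"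
    "\<alpha> 0 = 0" "\<alpha> (pi/4) = pi"
proof -
  let ?I = "{0<..<pi/4}"
  let ?b = "\<lambda>s. 4 * h s / sin (4 * s)"
  \<comment> \<open>An explicit antiderivative of \<open>4 / sin (4 * s)\<close>, unbounded at both
    ends; it serves as comparison function for \<open>B\<close>.\<close>
  let ?L = "\<lambda>s::real. ln (tan (2 * s))"
  define m where "m = min a1 a3"
  have m: "m > 0" "\<And>s. h s \<ge> m" using a_pos h_ge by (auto simp: m_def)
  have "isCont ?b s" if "s \<in> ?I" for s
    using trig_pos[OF that] isCont_h by (intro continuous_intros) auto
  then have "\<exists>B. \<forall>s. ereal 0 < ereal s \<longrightarrow> ereal s < ereal (pi/4) \<longrightarrow> (B has_vector_derivative ?b s) (at s)"
    by (intro einterval_antiderivative) auto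
  then obtain B where B: "\<And>s. s \<in> ?I \<Longrightarrow> (B has_real_derivative ?b s) (at s)"
    by (auto simp: has_real_derivative_iff_has_vector_derivative)
  have L: "(?L has_real_derivative 4 / sin (4 * s)) (at s)" if "s \<in> ?I" for s
  proof -
    note pos = trig_pos[OF that]
    have "tan (2 * s) > 0" using pos by (simp add: tan_def)
    then have "(?L has_real_derivative 1 / tan (2 * s) * (inverse ((cos (2 * s))\<^sup>2) * 2)) (at s)"
      using pos by (auto intro!: derivative_eq_intros)
    moreover have "sin (4 * s) = 2 * sin (2 * s) * cos (2 * s)" using sin_double[of "2 * s"] by simp
    then have "1 / tan (2 * s) * (inverse ((cos (2 * s))\<^sup>2) * 2) = 4 / sin (4 * s)"
      using pos by (simp add: tan_def power2_eq_square divide_simps)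
    ultimately show ?thesis by simp
  qed
  \<comment> \<open>The derivative of the difference is \<open>4 * (h x - m) / sin (4 * x)\<close>,
    which is nonnegative by the choice of \<open>m\<close>.\<close>
  have mono: "B s - m * ?L s \<le> B t - m * ?L t" if "s \<in> ?I" "t \<in> ?I" "s \<le> t" for s t
  proof (rule DERIV_nonneg_imp_nondecreasing[OF that(3)])
    fix x assume "s \<le> x" "x \<le> t"
    then have x: "x \<in> ?I" using that by auto
    have "((\<lambda>x. B x - m * ?L x) has_real_derivative ?b x - m * (4 / sin (4*x))) (at x)"
      by (intro DERIV_diff DERIV_cmult B L x)
    moreover have "?b x - m * (4 / sin (4*x)) \<ge> 0"
      using trig_pos(7)[OF x] m(2)[of x] by (simp add: field_simps)
    ultimately show "\<exists>y. ((\<lambda>x. B x - m * ?L x) has_real_derivative y) (at x) \<and> 0 \<le> y" by blast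
  qed
  \<comment> \<open>Comparison with the midpoint: \<open>B\<close> lies below
    \<open>?c + m * ?L\<close> to its left and above it to its right, so \<open>B\<close> tends to
    minus infinity at 0 and to plus infinity at \<open>pi/4\<close>.\<close>
  let ?c = "B (pi/8) - m * ?L (pi/8)"
  have mid: "pi/8 \<in> ?I" by simp
  have near0: "eventually (\<lambda>s. s \<in> {0<..<pi/8}) (at_right 0)"
    by (rule eventually_at_right_real) simp
  have near1: "eventually (\<lambda>s. s \<in> {pi/8<..<pi/4}) (at_left (pi/4))"
    by (rule eventually_at_left_real) simp
  have B0: "filterlim B at_bot (at_right 0)"
  proof (rule filterlim_at_bot_mono)
    have "filterlim (\<lambda>s::real. tan (2 * s)) (at_right 0) (at_right 0)"
    proof (subst filterlim_at, intro conjI)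
      show "((\<lambda>s::real. tan (2 * s)) \<longlongrightarrow> 0) (at_right 0)"
        by (auto intro!: tendsto_eq_intros)
      show "eventually (\<lambda>s::real. tan (2 * s) \<in> {0<..} \<and> tan (2 * s) \<noteq> 0) (at_right 0)"
        using near0
      proof eventually_elim
        case (elim s)
        then have "tan (2 * s) > 0" by (intro tan_gt_zero) auto
        then show ?case by simp
      qed
    qed
    then have "filterlim ?L at_bot (at_right 0)" by (rule filterlim_compose[OF ln_at_0])
    then have "filterlim (\<lambda>s. m * ?L s) at_bot (at_right 0)"
      using filterlim_tendsto_pos_mult_at_bot[OF tendsto_const m(1)] by blast
    then show "filterlim (\<lambda>s. ?c + m * ?L s) at_bot (at_right 0)"
      by (simp only: filterlim_tendsto_add_at_bot_iff[OF tendsto_const])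
    show "eventually (\<lambda>s. B s \<le> ?c + m * ?L s) (at_right 0)"
      using near0
    proof eventually_elim
      case (elim s)
      then show ?case using mono[OF _ mid, of s] by simp
    qed
  qed
  have B1: "filterlim B at_top (at_left (pi/4))"
  proof (rule filterlim_at_top_mono)
    have "filterlim (\<lambda>s::real. 2 * s) (at_left (pi/2)) (at_left (pi/4))"
    proof (subst filterlim_at, intro conjI)
      show "((\<lambda>s::real. 2 * s) \<longlongrightarrow> pi/2) (at_left (pi/4))"
        by (auto intro!: tendsto_eq_intros)
      show "eventually (\<lambda>s::real. 2 * s \<in> {..<pi/2} \<and> 2 * s \<noteq> pi/2) (at_left (pi/4))"
        using near1 by eventually_elim auto
    qed
    then have "filterlim (\<lambda>s::real. tan (2 * s)) at_top (at_left (pi/4))"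
      by (rule filterlim_compose[OF filterlim_tan_at_left])
    then have "filterlim ?L at_top (at_left (pi/4))"
      by (rule filterlim_compose[OF ln_at_top])
    then have "filterlim (\<lambda>s. m * ?L s) at_top (at_left (pi/4))"
      using filterlim_tendsto_pos_mult_at_top[OF tendsto_const m(1)] by blast
    then show "filterlim (\<lambda>s. ?c + m * ?L s) at_top (at_left (pi/4))"
      by (rule filterlim_tendsto_add_at_top[OF tendsto_const])
    show "eventually (\<lambda>s. ?c + m * ?L s \<le> B s) (at_left (pi/4))"
      using near1
    proof eventually_elim
      case (elim s)
      then show ?case using mono[OF mid, of s] by simp
    qed
  qed
  define \<alpha> where "\<alpha> s = (if s \<le> 0 then 0 else if s \<ge> pi/4 then pi else 2 * arctan (exp (B s)))" for s
  have \<alpha>: "\<alpha> s = 2 * arctan (exp (B s))" if "s \<in> ?I" for s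
    using that by (simp add: \<alpha>_def)
  \<comment> \<open>With \<open>y = exp (B s)\<close> the right-hand side is the factor that the
    chain rule puts in front of \<open>?b s\<close>, which turns the derivative of
    \<open>\<alpha>\<close> into \<open>?b s * sin (\<alpha> s)\<close>.\<close>
  have sin_\<alpha>: "sin (2 * arctan y) = 2 * y / (1 + y\<^sup>2)" for y :: real
  proof -
    have "sqrt (1 + y\<^sup>2) * sqrt (1 + y\<^sup>2) = 1 + y\<^sup>2" by (simp add: add_nonneg_nonneg)
    then show ?thesis by (simp add: sin_double sin_arctan cos_arctan)
  qed
  show thesis
  proof (rule that)
    show "(\<alpha> has_real_derivative 4 * h s * sin (\<alpha> s) / sin (4 * s)) (at s)" if s: "s \<in> ?I" for s
    proof (rule DERIV_cong[OF has_field_derivative_transform_within_open[OF _ _ s \<alpha>[symmetric]]])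
      show "((\<lambda>s. 2 * arctan (exp (B s))) has_real_derivative
          2 * (inverse (1 + (exp (B s))\<^sup>2) * (exp (B s) * ?b s))) (at s)"
        by (auto intro!: derivative_eq_intros B[OF s])
      show "2 * (inverse (1 + (exp (B s))\<^sup>2) * (exp (B s) * ?b s)) = 4 * h s * sin (\<alpha> s) / sin (4 * s)"
        by (simp only: \<alpha>[OF s] sin_\<alpha>) (simp add: divide_inverse)
    qed auto
    have "smooth_on ?I ?b"
      unfolding divide_inverse
      by (intro smooth_on_mult smooth_on_inverse smooth_on_sin smooth_on_const smooth_on_h
          smooth_on_linear bounded_linear_ident open_greaterThanLessThan less_imp_neq[symmetric] trig_pos(7)) auto
    then have "smooth_on ?I B"
      by (intro smooth_on_real_antiderivative[OF open_greaterThanLessThan, of 0 "pi/4" B ?b] B)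
    then have "smooth_on ?I (\<lambda>s. 2 * arctan (exp (B s)))"
      by (intro smooth_on_mult smooth_on_const smooth_on_arctan smooth_on_exp open_greaterThanLessThan)
    then show "smooth_on ?I \<alpha>"
      by (rule smooth_on_cong[OF open_greaterThanLessThan, rotated]) (simp add: \<alpha>)
    show "\<alpha> s \<in> {0<..<pi}" if s: "s \<in> ?I" for s
      unfolding \<alpha>[OF s] using arctan_ubound[of "exp (B s)"] by simp
    have "((\<lambda>s. 2 * arctan (exp (B s))) \<longlongrightarrow> 2 * arctan 0) (at_right 0)"
      by (intro tendsto_intros filterlim_compose[OF exp_at_bot B0])
    then have "((\<lambda>s. 2 * arctan (exp (B s))) \<longlongrightarrow> 0) (at_right 0)" by simp
    then show "(\<alpha> \<longlongrightarrow> 0) (at_right 0)"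
    proof (rule Lim_transform_eventually)
      show "eventually (\<lambda>s. 2 * arctan (exp (B s)) = \<alpha> s) (at_right 0)"
        using near0 by eventually_elim (simp add: \<alpha>)
    qed
    have "((\<lambda>s. 2 * arctan (exp (B s))) \<longlongrightarrow> 2 * (pi/2)) (at_left (pi/4))"
      by (intro tendsto_intros filterlim_compose[OF tendsto_arctan_at_top]
          filterlim_compose[OF exp_at_top B1])
    then have "((\<lambda>s. 2 * arctan (exp (B s))) \<longlongrightarrow> pi) (at_left (pi/4))" by simp
    then show "(\<alpha> \<longlongrightarrow> pi) (at_left (pi/4))"
    proof (rule Lim_transform_eventually)
      show "eventually (\<lambda>s. 2 * arctan (exp (B s)) = \<alpha> s) (at_left (pi/4))"
        using near1 by eventually_elim (simp add: \<alpha>)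
    qed
  qed (use pi_gt_zero in \<open>auto simp: \<alpha>_def simp del: pi_gt_zero\<close>)
qed

end

section \<open>The map into the sphere\<close>

text \<open>Together with \<open>e_angular\<close> and \<open>e_axial\<close> this is the
  orthonormal frame of cylindrical coordinates.\<close>

definition e_radial :: "real \<Rightarrow> complex \<times> real" where "e_radial \<theta> = (cis \<theta>, 0)"
definition e_angular :: "real \<Rightarrow> complex \<times> real" where "e_angular \<theta> = (\<i> * cis \<theta>, 0)"
definition e_axial :: "complex \<times> real" where "e_axial = (0, 1)"

lemma frame_inner [simp]:
  "e_radial \<theta> \<bullet> e_radial \<theta> = 1" "e_angular \<theta> \<bullet> e_angular \<theta> = 1" "e_axial \<bullet> e_axial = 1"
  "e_radial \<theta> \<bullet> e_angular \<theta> = 0" "e_angular \<theta> \<bullet> e_radial \<theta> = 0"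
  "e_radial \<theta> \<bullet> e_axial = 0" "e_axial \<bullet> e_radial \<theta> = 0"
  "e_angular \<theta> \<bullet> e_axial = 0" "e_axial \<bullet> e_angular \<theta> = 0"
  by (simp_all add: e_radial_def e_angular_def e_axial_def inner_complex_def
      power2_eq_square[symmetric])

lemma frame_expansion:
  "v = (v \<bullet> e_radial \<theta>) *\<^sub>R e_radial \<theta> + (v \<bullet> e_angular \<theta>) *\<^sub>R e_angular \<theta> + (v \<bullet> e_axial) *\<^sub>R e_axial"
proof -
  obtain a b c where v: "v = (Complex a b, c)" by (metis complex.exhaust prod.exhaust)
  have cs: "cos \<theta> * cos \<theta> = 1 - sin \<theta> * sin \<theta>"
    using sin_cos_squared_add[of \<theta>] by (simp add: power2_eq_square)
  show ?thesis
    by (simp add: v e_radial_def e_angular_def e_axial_def inner_complex_def complex_eq_iff)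
      (simp add: algebra_simps cs)
qed

lemma e_radial_has_derivative:
  assumes "(f has_derivative f') (at x)"
  shows "((\<lambda>x. e_radial (f x)) has_derivative (\<lambda>v. f' v *\<^sub>R e_angular (f x))) (at x)"
proof -
  have "((\<lambda>x. Complex (cos (f x)) (sin (f x))) has_derivative
      (\<lambda>v. Complex (- sin (f x) * f' v) (cos (f x) * f' v))) (at x)"
    unfolding Complex_eq by (auto intro!: derivative_eq_intros assms simp: algebra_simps)
  then have "((\<lambda>x. (cis (f x), 0::real)) has_derivative
      (\<lambda>v. (Complex (- sin (f x) * f' v) (cos (f x) * f' v), 0))) (at x)"
    by (intro has_derivative_Pair has_derivative_const) (simp add: cis_conv_exp[symmetric] cis.code)
  moreover have "(\<lambda>v. (Complex (- sin (f x) * f' v) (cos (f x) * f' v), 0)) = (\<lambda>v. f' v *\<^sub>R e_angular (f x))"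
    by (simp add: e_angular_def complex_eq_iff fun_eq_iff)
  ultimately show ?thesis
    unfolding e_radial_def by (simp only:)
qed

text \<open>The angular vector is the radial one after a quarter turn, so the rule for
  \<open>e_radial\<close> applies to the shifted angle.\<close>

lemma e_angular_has_derivative:
  assumes "(f has_derivative f') (at x)"
  shows "((\<lambda>x. e_angular (f x)) has_derivative (\<lambda>v. - (f' v) *\<^sub>R e_radial (f x))) (at x)"
proof -
  have e: "e_angular \<theta> = e_radial (\<theta> + pi/2)" "e_angular (\<theta> + pi/2) = - e_radial \<theta>" for \<theta>
    by (auto simp: e_angular_def e_radial_def complex_eq_iff sin_add cos_add)
  have "((\<lambda>x. f x + pi/2) has_derivative f') (at x)"
    by (auto intro!: derivative_eq_intros assms)
  from e_radial_has_derivative[OF this, unfolded e(2)] show ?thesis by (simp add: e(1))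
qed

lemma continuous_on_e_radial: "continuous_on S f \<Longrightarrow> continuous_on S (\<lambda>x. e_radial (f x))"
  unfolding e_radial_def by (intro continuous_intros)

lemma smooth_on_e_radial:
  assumes "open S" "smooth_on S f"
  shows "smooth_on S (\<lambda>x. e_radial (f x))"
proof -
  have "e_radial \<theta> = cos \<theta> *\<^sub>R (1, 0) + sin \<theta> *\<^sub>R (\<i>, 0)" for \<theta>
    by (simp add: e_radial_def complex_eq_iff)
  then show ?thesis
    by (simp only:) (intro smooth_on_add smooth_on_scaleR smooth_on_cos smooth_on_sin
        smooth_on_const assms)
qed

lemma smooth_on_vec_nth: "open S \<Longrightarrow> smooth_on S (\<lambda>x::real^'n. x $ i)"
  by (rule smooth_on_linear[OF _ bounded_linear_vec_nth])

text \<open>The differential equation drives conformality and harmonicity; the limits and the values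
  at the end points serve the continuous extension.\<close>

locale Q5_profile = Q5_setting +
  fixes \<alpha> :: "real \<Rightarrow> real"
  assumes \<alpha>_deriv: "\<And>s. s \<in> {0<..<pi/4} \<Longrightarrow>
      (\<alpha> has_real_derivative 4 * h s * sin (\<alpha> s) / sin (4 * s)) (at s)"
    and \<alpha>_smooth: "smooth_on {0<..<pi/4} \<alpha>"
    and \<alpha>_range: "\<And>s. s \<in> {0<..<pi/4} \<Longrightarrow> \<alpha> s \<in> {0<..<pi}"
    and \<alpha>_lim0: "(\<alpha> \<longlongrightarrow> 0) (at_right 0)"
    and \<alpha>_lim1: "(\<alpha> \<longlongrightarrow> pi) (at_left (pi/4))"
    and \<alpha>_0: "\<alpha> 0 = 0" and \<alpha>_1: "\<alpha> (pi/4) = pi"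
begin

abbreviation "\<phi> \<equiv> phi_map k1 k2 k3 k4 \<alpha>"

text \<open>The right-hand side of the differential equation, hence the derivative of
  \<open>\<alpha>\<close> for \<open>s\<close> in the open interval.\<close>

definition "\<alpha>' s = 4 * h s * sin (\<alpha> s) / sin (4 * s)"

text \<open>The derivative of the map with respect to the polar angle \<open>\<alpha>\<close>. With
  \<open>e_angular (\<Theta> x)\<close> it forms an orthonormal basis of the tangent plane of the
  sphere at \<open>\<phi> x\<close>.\<close>

definition "e_polar x = cos (\<alpha> (x$5)) *\<^sub>R e_radial (\<Theta> x) - sin (\<alpha> (x$5)) *\<^sub>R e_axial"

lemma phi_eq: "\<phi> x = sin (\<alpha> (x$5)) *\<^sub>R e_radial (\<Theta> x) + cos (\<alpha> (x$5)) *\<^sub>R e_axial"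
  by (simp add: phi_map_def e_radial_def e_axial_def \<Theta>_def cis_conv_exp scaleR_conv_of_real)

lemma e_polar_inner [simp]:
  "e_polar x \<bullet> e_polar x = 1" "e_polar x \<bullet> e_angular (\<Theta> x) = 0" "e_angular (\<Theta> x) \<bullet> e_polar x = 0"
  "\<phi> x \<bullet> e_polar x = 0" "\<phi> x \<bullet> e_angular (\<Theta> x) = 0"
  "e_polar x \<bullet> \<phi> x = 0" "e_angular (\<Theta> x) \<bullet> \<phi> x = 0" "\<phi> x \<bullet> \<phi> x = 1"
  by (simp_all add: phi_eq e_polar_def inner_add_left inner_add_right inner_diff_left
      inner_diff_right power2_eq_square[symmetric] mult.commute)

text \<open>The pair \<open>\<phi> x\<close>, \<open>e_polar x\<close> arises from the radial and
  axial vectors by a symmetric orthogonal matrix, which is its own inverse.\<close>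

lemma e_radial_eq: "e_radial (\<Theta> x) = sin (\<alpha> (x$5)) *\<^sub>R \<phi> x + cos (\<alpha> (x$5)) *\<^sub>R e_polar x"
  by (simp add: phi_eq e_polar_def algebra_simps scaleR_add_left[symmetric] power2_eq_square[symmetric])

lemma e_axial_eq: "e_axial = cos (\<alpha> (x$5)) *\<^sub>R \<phi> x - sin (\<alpha> (x$5)) *\<^sub>R e_polar x"
  by (simp add: phi_eq e_polar_def algebra_simps scaleR_add_left[symmetric] power2_eq_square[symmetric])

lemma Q5_s: "x \<in> Q5_coords \<Longrightarrow> x$5 \<in> {0<..<pi/4}"
  by (simp add: Q5_coords_def)

lemma sin_\<alpha>_pos: "x \<in> Q5_coords \<Longrightarrow> sin (\<alpha> (x$5)) > 0"
  using \<alpha>_range[OF Q5_s] by (simp add: sin_gt_zero)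

lemma \<alpha>'_pos: "x \<in> Q5_coords \<Longrightarrow> \<alpha>' (x$5) > 0"
  using sin_\<alpha>_pos[of x] h_pos[of "x$5"] trig_pos(7)[OF Q5_s, of x] by (simp add: \<alpha>'_def)

lemma \<alpha>_has_derivative:
  assumes "x \<in> Q5_coords"
  shows "((\<lambda>x. \<alpha> (x$5)) has_derivative (\<lambda>v. \<alpha>' (x$5) * v$5)) (at x)"
proof -
  have "(\<alpha> has_derivative (\<lambda>r. \<alpha>' (x$5) * r)) (at (x$5))"
    using \<alpha>_deriv[OF Q5_s[OF assms]] unfolding has_field_derivative_def \<alpha>'_def .
  moreover have "((\<lambda>x::real^5. x$5) has_derivative (\<lambda>v. v$5)) (at x)"
    by (rule bounded_linear_imp_has_derivative[OF bounded_linear_vec_nth])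
  ultimately show ?thesis
    using diff_chain_at[of "\<lambda>x. x$5" "\<lambda>v. v$5" x \<alpha>] by (simp add: o_def)
qed

lemma \<Theta>_has_derivative: "(\<Theta> has_derivative \<Theta>) (at x)"
  by (rule bounded_linear_imp_has_derivative[OF bounded_linear_\<Theta>])

lemma e_polar_has_derivative:
  assumes "x \<in> Q5_coords"
  shows "(e_polar has_derivative (\<lambda>v. - (\<alpha>' (x$5) * v$5) *\<^sub>R \<phi> x
    + (cos (\<alpha> (x$5)) * \<Theta> v) *\<^sub>R e_angular (\<Theta> x))) (at x)"
  unfolding e_polar_def
  by (rule has_derivative_eq_rhs,
      (rule has_derivative_diff has_derivative_scaleR has_derivative_sin has_derivative_cos
        \<alpha>_has_derivative[OF assms] e_radial_has_derivative[OF \<Theta>_has_derivative] has_derivative_const)+)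
    (simp add: phi_eq fun_eq_iff algebra_simps)

lemma phi_has_derivative:
  assumes "x \<in> Q5_coords"
  shows "(\<phi> has_derivative (\<lambda>v. (\<alpha>' (x$5) * v$5) *\<^sub>R e_polar x
    + (sin (\<alpha> (x$5)) * \<Theta> v) *\<^sub>R e_angular (\<Theta> x))) (at x)"
  unfolding phi_eq
  by (rule has_derivative_eq_rhs,
      (rule has_derivative_add has_derivative_scaleR has_derivative_sin has_derivative_cos
        \<alpha>_has_derivative[OF assms] e_radial_has_derivative[OF \<Theta>_has_derivative] has_derivative_const)+)
    (simp add: e_polar_def fun_eq_iff algebra_simps)

lemma frechet_phi:
  assumes "x \<in> Q5_coords"
  shows "frechet_derivative \<phi> (at x) v = (\<alpha>' (x$5) * v$5) *\<^sub>R e_polar x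
    + (sin (\<alpha> (x$5)) * \<Theta> v) *\<^sub>R e_angular (\<Theta> x)"
  using frechet_derivative_at[OF phi_has_derivative[OF assms], symmetric] by (rule fun_cong)

lemma \<Theta>_axis: "\<Theta> (axis i r) = \<kappa> i * r"
  by (simp add: \<Theta>_eq_sum axis_def mult_delta_right)

lemma smooth_sphere_map_phi: "smooth_sphere_map \<phi>"
  unfolding smooth_sphere_map_def
proof (intro conjI)
  have \<alpha>: "smooth_on Q5_coords (\<lambda>x. \<alpha> (x$5))"
    by (rule smooth_on_compose[OF \<alpha>_smooth open_Q5_coords open_greaterThanLessThan
          smooth_on_vec_nth[OF open_Q5_coords] Q5_s])
  show "smooth_on Q5_coords \<phi>"
    unfolding phi_eq
    by (intro smooth_on_add smooth_on_scaleR smooth_on_sin smooth_on_cos smooth_on_e_radial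
        smooth_on_const \<alpha> smooth_on_linear[OF open_Q5_coords bounded_linear_\<Theta>] open_Q5_coords)
  show "angle_periodic \<phi>"
    unfolding angle_periodic_def
  proof (intro ballI allI impI)
    fix x :: "real^5" and i :: 5 assume i: "i \<noteq> 5"
    \<comment> \<open>Integrality enters here: a full turn of one angle changes the phase by a
      multiple of \<open>2 * pi\<close>.\<close>
    obtain n :: int where n: "\<kappa> i = of_int n"
      unfolding \<kappa>_def by (metis of_int_0)
    have "\<Theta> (x + axis i (2*pi)) = \<Theta> x + \<Theta> (axis i (2*pi))"
      using bounded_linear_\<Theta> by (simp add: linear_add bounded_linear.linear)
    moreover have "\<Theta> (axis i (2*pi)) = 2 * pi * of_int n"
      by (simp add: \<Theta>_axis n)
    ultimately have "e_radial (\<Theta> (x + axis i (2*pi))) = e_radial (\<Theta> x)"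
      by (simp add: e_radial_def cis_mult[symmetric] cis_multiple_2pi)
    moreover have "(x + axis i (2*pi)) $ 5 = x $ 5" using i by (simp add: axis_def)
    ultimately show "\<phi> (x + axis i (2*pi)) = \<phi> x" by (simp only: phi_eq)
  qed
  show "\<phi> ` Q5_coords \<subseteq> sphere 0 1"
    by (auto simp: norm_eq_1)
qed

section \<open>Horizontal vectors and conformality\<close>

lemma metric_inner_g: "metric_inner (g x) X Y = (\<Sum>i\<in>UNIV. gd (x$5) i * X$i * Y$i)"
proof -
  have "(g x *v Y) $ i = gd (x$5) i * Y$i" for i
    by (simp add: matrix_vector_mult_def g_nth mult_delta_left)
  then show ?thesis by (simp add: metric_inner_def inner_vec_def mult_ac)
qed

lemma metric_inner_axis: "metric_inner (g x) X (axis i r) = gd (x$5) i * X$i * r"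
  by (simp add: metric_inner_g axis_def mult_delta_right)

lemma metric_inner_diff: "metric_inner (g x) X (V - W) = metric_inner (g x) X V - metric_inner (g x) X W"
  by (simp add: metric_inner_g right_diff_distrib sum_subtractf)

text \<open>Since \<open>\<alpha>'\<close> and \<open>sin \<alpha>\<close> are positive, the kernel
  of the differential is cut out by \<open>ds\<close> and the differential of
  \<open>\<Theta>\<close>. Its orthogonal complement is spanned by the last coordinate vector and
  the gradient of \<open>\<Theta>\<close>; \<open>\<mu>\<close> is the coefficient of the gradient,
  and \<open>X$5\<close> is free.\<close>

lemma horizontal_space_phi:
  assumes x: "x \<in> Q5_coords"
  shows "X \<in> horizontal_space g \<phi> x \<longleftrightarrow> (\<exists>\<mu>. \<forall>i. i \<noteq> 5 \<longrightarrow> gd (x$5) i * X$i = \<mu> * \<kappa> i)"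
proof
  have kernel: "frechet_derivative \<phi> (at x) V = 0 \<longleftrightarrow> V$5 = 0 \<and> \<Theta> V = 0" for V
  proof
    assume "frechet_derivative \<phi> (at x) V = 0"
    then have "frechet_derivative \<phi> (at x) V \<bullet> e_polar x = 0"
      "frechet_derivative \<phi> (at x) V \<bullet> e_angular (\<Theta> x) = 0" by simp_all
    then show "V$5 = 0 \<and> \<Theta> V = 0"
      using \<alpha>'_pos[OF x] sin_\<alpha>_pos[OF x] by (simp add: frechet_phi[OF x] inner_add_left)
  qed (simp add: frechet_phi[OF x])
  {
    assume "X \<in> horizontal_space g \<phi> x"
    then have X: "metric_inner (g x) X V = 0" if "V$5 = 0" "\<Theta> V = 0" for V
      using that kernel by (auto simp: horizontal_space_def)
    have "gd (x$5) i * X$i = (gd (x$5) 1 * X$1 / \<kappa> 1) * \<kappa> i" if i: "i \<noteq> 5" for i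
    proof -
      \<comment> \<open>A kernel vector that involves the angles 1 and \<open>i\<close> only;
        orthogonality to it compares the two components of \<open>X\<close>.\<close>
      let ?V = "axis i (\<kappa> 1) - axis 1 (\<kappa> i) :: real^5"
      have "?V $ 5 = 0" using i by (simp add: axis_def)
      moreover have "\<Theta> ?V = 0"
        using linear_diff[OF bounded_linear.linear[OF bounded_linear_\<Theta>]] by (simp add: \<Theta>_axis)
      ultimately have "metric_inner (g x) X ?V = 0" by (rule X)
      then have "gd (x$5) i * X$i * \<kappa> 1 = gd (x$5) 1 * X$1 * \<kappa> i"
        by (simp add: metric_inner_diff metric_inner_axis)
      then show ?thesis using \<kappa>_nonzero(1) by (simp add: field_simps)
    qed
    then show "\<exists>\<mu>. \<forall>i. i \<noteq> 5 \<longrightarrow> gd (x$5) i * X$i = \<mu> * \<kappa> i" by blast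
  }
  assume "\<exists>\<mu>. \<forall>i. i \<noteq> 5 \<longrightarrow> gd (x$5) i * X$i = \<mu> * \<kappa> i"
  then obtain \<mu> where \<mu>: "\<And>i. i \<noteq> 5 \<Longrightarrow> gd (x$5) i * X$i = \<mu> * \<kappa> i" by blast
  have "metric_inner (g x) X V = 0" if "V$5 = 0" "\<Theta> V = 0" for V
  proof -
    have "gd (x$5) i * X$i * V$i = \<mu> * (\<kappa> i * V$i)" for i
      using \<mu>[of i] that(1) by (cases "i = 5") auto
    then have "metric_inner (g x) X V = \<mu> * \<Theta> V"
      by (simp only: metric_inner_g \<Theta>_eq_sum sum_distrib_left)
    then show ?thesis using that by simp
  qed
  then show "X \<in> horizontal_space g \<phi> x"
    using kernel by (auto simp: horizontal_space_def)
qed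

lemma horizontally_weakly_conformal_phi:
  assumes x: "x \<in> Q5_coords"
  shows "horizontally_weakly_conformal_at g \<phi> x"
proof -
  let ?s = "x$5" and ?D = "frechet_derivative \<phi> (at x)" and ?H = "horizontal_space g \<phi> x"
  let ?p = "\<alpha>' (x$5)" and ?q = "sin (\<alpha> (x$5))"
  define N where "N = (\<Sum>i\<in>UNIV. (\<kappa> i)\<^sup>2 / gd ?s i)"
  have s: "?s \<in> {0<..<pi/4}" by (rule Q5_s[OF x])
  have N: "N = 16 / (sin (4 * ?s))\<^sup>2" unfolding N_def by (rule sum_\<kappa>_sq_over_gd[OF s])
  have pos: "N > 0" "?p > 0" "?q > 0" "\<And>i. gd ?s i > 0"
    using trig_pos(7)[OF s] \<alpha>'_pos[OF x] sin_\<alpha>_pos[OF x] gd_pos[OF s] by (simp_all add: N)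
  \<comment> \<open>The squared differential equation. It says that the last coordinate direction is
    stretched by the same factor \<open>?q\<^sup>2 * N\<close> as the gradient of the phase.\<close>
  have p_sq: "?p\<^sup>2 = ?q\<^sup>2 * N * gd ?s 5"
    by (simp add: \<alpha>'_def N gd_def power_mult_distrib power_divide)
  have \<Theta>_hor: "\<Theta> X = \<mu> * N" if "\<And>i. i \<noteq> 5 \<Longrightarrow> gd ?s i * X$i = \<mu> * \<kappa> i" for X \<mu>
  proof -
    have "\<kappa> i * X$i = \<mu> * ((\<kappa> i)\<^sup>2 / gd ?s i)" for i
      using that[of i] pos(4)[of i] by (cases "i = 5") (auto simp: field_simps power2_eq_square)
    then show ?thesis by (simp only: \<Theta>_eq_sum N_def sum_distrib_left)
  qed
  have conformal: "?q\<^sup>2 * N * metric_inner (g x) X Y = ?D X \<bullet> ?D Y" if "X \<in> ?H" for X Y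
  proof -
    obtain \<mu> where \<mu>: "\<And>i. i \<noteq> 5 \<Longrightarrow> gd ?s i * X$i = \<mu> * \<kappa> i"
      using \<open>X \<in> ?H\<close> horizontal_space_phi[OF x] by blast
    have "gd ?s i * X$i * Y$i = \<mu> * (\<kappa> i * Y$i) + (if i = 5 then gd ?s 5 * X$5 * Y$5 else 0)" for i
      using \<mu>[of i] by (cases "i = 5") auto
    then have "metric_inner (g x) X Y
        = (\<Sum>i\<in>UNIV. \<mu> * (\<kappa> i * Y$i) + (if i = 5 then gd ?s 5 * X$5 * Y$5 else 0))"
      unfolding metric_inner_g by (rule sum.cong[OF refl])
    also have "\<dots> = \<mu> * \<Theta> Y + gd ?s 5 * X$5 * Y$5"
      by (simp add: \<Theta>_eq_sum sum_distrib_left sum.distrib)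
    finally have "metric_inner (g x) X Y = \<mu> * \<Theta> Y + gd ?s 5 * X$5 * Y$5" .
    moreover have "?D X \<bullet> ?D Y = ?p\<^sup>2 * (X$5 * Y$5) + ?q\<^sup>2 * (\<Theta> X * \<Theta> Y)"
      by (simp add: frechet_phi[OF x] inner_add_left inner_add_right power2_eq_square)
    ultimately show ?thesis
      using \<Theta>_hor[OF \<mu>] p_sq by (simp add: algebra_simps)
  qed
  have "?D ` ?H = sphere_tangent (\<phi> x)"
  proof (intro equalityI subsetI)
    fix v assume "v \<in> ?D ` ?H"
    then show "v \<in> sphere_tangent (\<phi> x)"
      by (auto simp: sphere_tangent_def frechet_phi[OF x] inner_add_right)
  next
    fix v assume "v \<in> sphere_tangent (\<phi> x)"
    then have v0: "v \<bullet> \<phi> x = 0" by (simp add: sphere_tangent_def inner_commute)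
    \<comment> \<open>The remainder is orthogonal to \<open>\<phi> x\<close> and to both tangent
      frame vectors, hence to the cylindrical frame, so it is zero.\<close>
    let ?w = "v - ((v \<bullet> e_polar x) *\<^sub>R e_polar x + (v \<bullet> e_angular (\<Theta> x)) *\<^sub>R e_angular (\<Theta> x))"
    have "?w \<bullet> e_polar x = 0" "?w \<bullet> e_angular (\<Theta> x) = 0" "?w \<bullet> \<phi> x = 0"
      using v0 by (simp_all add: inner_diff_left inner_add_left)
    then have "?w = 0"
      using frame_expansion[of ?w "\<Theta> x"] by (simp only: e_radial_eq e_axial_eq[of x] inner_add_right inner_diff_right
          inner_scaleR_right mult_zero_right scaleR_zero_left add_0_right diff_0_right)
    then have v: "v = (v \<bullet> e_polar x) *\<^sub>R e_polar x + (v \<bullet> e_angular (\<Theta> x)) *\<^sub>R e_angular (\<Theta> x)"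
      by (simp only: right_minus_eq)
    \<comment> \<open>A horizontal vector with coefficient \<open>\<mu>\<close> has phase derivative
      \<open>\<mu> * N\<close>, so this choice reproduces the angular component of \<open>v\<close>;
      the last entry of \<open>X\<close> below does the same for the polar one.\<close>
    define \<mu> where "\<mu> = (v \<bullet> e_angular (\<Theta> x)) / (?q * N)"
    define X :: "real^5" where
      "X = (\<chi> i. if i = 5 then (v \<bullet> e_polar x) / ?p else \<mu> * \<kappa> i / gd ?s i)"
    have X: "gd ?s i * X$i = \<mu> * \<kappa> i" if "i \<noteq> 5" for i
      using that pos(4)[of i] by (simp add: X_def)
    then have "X \<in> ?H" using horizontal_space_phi[OF x] by blast
    moreover have "?D X = v"
    proof -
      have "?p * X$5 = v \<bullet> e_polar x" using pos by (simp add: X_def)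
      moreover have "?q * \<Theta> X = v \<bullet> e_angular (\<Theta> x)"
        using \<Theta>_hor[OF X] pos by (simp add: \<mu>_def)
      ultimately show ?thesis unfolding frechet_phi[OF x] using v by simp
    qed
    ultimately show "v \<in> ?D ` ?H" by blast
  qed
  moreover have "\<exists>\<Lambda>>0. \<forall>X\<in>?H. \<forall>Y\<in>?H. \<Lambda> * metric_inner (g x) X Y = ?D X \<bullet> ?D Y"
    using conformal pos by (intro exI[of _ "?q\<^sup>2 * N"]) auto
  ultimately show ?thesis unfolding horizontally_weakly_conformal_at_def by blast
qed

end

text \<open>The preimage of a closed set under \<open>f\<close> is compact in \<open>K\<close>, so
  its image under \<open>p\<close> is compact and therefore closed. By the relation between
  \<open>F\<close> and \<open>f\<close> that image is the preimage under \<open>F\<close>.\<close>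

lemma continuous_on_compact_quotient:
  fixes p :: "'a::t2_space \<Rightarrow> 'b::t2_space" and f :: "'a \<Rightarrow> 'c::topological_space"
  assumes "compact K" "continuous_on K p" "continuous_on K f"
    and F: "\<And>x. x \<in> K \<Longrightarrow> F (p x) = f x"
  shows "continuous_on (p ` K) F"
  unfolding continuous_on_closed_invariant
proof (intro allI impI)
  fix B :: "'c set" assume "closed B"
  then obtain A where A: "closed A" "A \<inter> K = f -` B \<inter> K"
    using assms(3) unfolding continuous_on_closed_invariant by blast
  have "compact (A \<inter> K)" using A(1) assms(1) by (rule closed_Int_compact)
  then have "compact (p ` (A \<inter> K))"
    using continuous_on_subset[OF assms(2)] by (intro compact_continuous_image) auto
  then have "closed (p ` (A \<inter> K))" by (rule compact_imp_closed)
  moreover have "p ` (A \<inter> K) \<inter> p ` K = F -` B \<inter> p ` K"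
    unfolding A(2) using F by auto
  ultimately show "\<exists>A. closed A \<and> A \<inter> p ` K = F -` B \<inter> p ` K" by blast
qed

section \<open>The tension field of the map\<close>

context Q5_profile
begin

lemma continuous_on_gd: "continuous_on S (\<lambda>x::real^5. gd (x$5) i)"
  using exhaust_5[of i] by (elim disjE) (auto simp: gd_def h_fun_def intro!: continuous_intros)

text \<open>The angular terms add up to a multiple of \<open>e_radial\<close>. The term in
  \<open>s\<close> is the same multiple of
  \<open>?C x *\<^sub>R e_polar x - ?S x *\<^sub>R \<phi> x\<close>, with opposite sign. Written in
  the basis \<open>\<phi>\<close>, \<open>e_polar\<close>, the polar parts cancel and a multiple of
  \<open>\<phi>\<close> remains.\<close>

lemma harmonic_phi: "harmonic_sphere_map g \<phi>"
proof -
  let ?K = "a1 * a2 * a3 * a4"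
  let ?w = "\<lambda>i x. volume_density g x / g x $ i $ i"
  let ?S = "\<lambda>x. sin (\<alpha> (x$5))" and ?C = "\<lambda>x. cos (\<alpha> (x$5))"
  define Z where "Z i x = - (?w i x * ?S x * (\<kappa> i)\<^sup>2) *\<^sub>R e_radial (\<Theta> x)
    + (if i = 5 then (?K / 2 * \<alpha>' (x$5)) *\<^sub>R (?C x *\<^sub>R e_polar x - ?S x *\<^sub>R \<phi> x) else 0)" for i x
  have w: "?w i x = ?K * h (x$5) * sin (4 * x$5) / 8 / gd (x$5) i" if "x \<in> Q5_coords" for i x
    using that by (simp add: volume_density_g g_nth)
  \<comment> \<open>The differential equation cancels both \<open>h\<close> and
    \<open>sin (4 * s)\<close>, so the flux in direction \<open>s\<close> is the simple field
    \<open>(?K / 2 * ?S x) *\<^sub>R e_polar x\<close>.\<close>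
  have w5: "?w 5 x * \<alpha>' (x$5) = ?K / 2 * ?S x" if "x \<in> Q5_coords" for x
    using h_pos[of "x$5"] trig_pos(7)[OF Q5_s[OF that]]
    by (simp add: w[OF that] \<alpha>'_def gd_def power2_eq_square field_simps)
  have \<alpha>_cont: "continuous_on Q5_coords (\<lambda>x. \<alpha> (x$5))"
    using \<alpha>_has_derivative has_derivative_continuous continuous_at_imp_continuous_on by blast
  have \<alpha>'_cont: "continuous_on Q5_coords (\<lambda>x. \<alpha>' (x$5))"
    unfolding \<alpha>'_def h_fun_def
    by (intro continuous_intros \<alpha>_cont) (use trig_pos(7)[OF Q5_s] in fastforce)
  have \<phi>_cont: "continuous_on Q5_coords \<phi>" by (rule smooth_sphere_mapD(3)[OF smooth_sphere_map_phi])
  have r_cont: "continuous_on Q5_coords (\<lambda>x. e_radial (\<Theta> x))"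
    by (intro continuous_on_e_radial linear_continuous_on bounded_linear_\<Theta>)
  have p_cont: "continuous_on Q5_coords e_polar"
    unfolding e_polar_def by (intro continuous_intros \<alpha>_cont r_cont)
  have w_cont: "continuous_on Q5_coords (?w i)" for i
  proof -
    have "continuous_on Q5_coords (\<lambda>x. ?K * h (x$5) * sin (4 * x$5) / 8 / gd (x$5) i)"
      unfolding h_fun_def by (intro continuous_intros continuous_on_gd)
        (use gd_pos[OF Q5_s] in \<open>auto simp: less_imp_neq[symmetric]\<close>)
    then show ?thesis by (rule continuous_on_eq) (simp add: w)
  qed
  show ?thesis
  proof (rule harmonic_sphere_mapI[where w = ?w and Z = Z and \<mu> = "\<lambda>x. ?K * \<alpha>' (x$5) * ?S x"])
    show "smooth_sphere_map \<phi>" by (rule smooth_sphere_map_phi)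
    show "continuous_on Q5_coords (?w i)" for i by (rule w_cont)
    show "continuous_on Q5_coords (\<lambda>x. ?K * \<alpha>' (x$5) * ?S x)"
      by (intro continuous_intros \<alpha>_cont \<alpha>'_cont)
    show "continuous_on Q5_coords (Z i)" for i
    proof -
      have 1: "continuous_on Q5_coords (\<lambda>x. - (?w i x * ?S x * (\<kappa> i)\<^sup>2) *\<^sub>R e_radial (\<Theta> x))"
        by (intro continuous_intros w_cont \<alpha>_cont r_cont)
      have 2: "continuous_on Q5_coords
          (\<lambda>x. (?K / 2 * \<alpha>' (x$5)) *\<^sub>R (?C x *\<^sub>R e_polar x - ?S x *\<^sub>R \<phi> x))"
        by (intro continuous_intros \<alpha>_cont \<alpha>'_cont \<phi>_cont p_cont) auto
      show ?thesis
        unfolding Z_def using continuous_on_add[OF 1 2] 1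
        by (cases "i = 5") (simp_all only: if_True if_False add_0_right simp_thms)
    qed
    show "g x $ i $ j = 0" if "i \<noteq> j" for x i j using that by (simp add: g_nth)
    show "g x $ i $ i > 0" if "x \<in> Q5_coords" for x i using gd_pos[OF Q5_s[OF that]] by (simp add: g_nth)
    fix x assume x: "x \<in> Q5_coords"
    note s = Q5_s[OF x]
    show "?w i (x + axis j (2*pi)) = ?w i x" if "j \<noteq> 5" for i j
    proof -
      have y: "x + axis j (2*pi) \<in> Q5_coords" using x that by (simp add: Q5_coords_shift)
      have "(x + axis j (2*pi)) $ 5 = x $ 5" using that by (simp add: axis_def)
      then show ?thesis by (simp only: w[OF x] w[OF y])
    qed
    show "((\<lambda>\<tau>. ?w i (x + \<tau> *\<^sub>R axis i 1) *\<^sub>R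
        frechet_derivative \<phi> (at (x + \<tau> *\<^sub>R axis i 1)) (axis i 1)) has_vector_derivative Z i x) (at 0)" for i
    proof (cases "i = 5")
      case False
      have y: "(x + \<tau> *\<^sub>R axis i 1) $ 5 = x $ 5" "x + \<tau> *\<^sub>R axis i 1 \<in> Q5_coords"
        "\<Theta> (x + \<tau> *\<^sub>R axis i 1) = \<Theta> x + \<tau> * \<kappa> i" for \<tau>
        using False x linear_add[OF bounded_linear.linear[OF bounded_linear_\<Theta>]]
          linear_cmul[OF bounded_linear.linear[OF bounded_linear_\<Theta>]]
        by (simp_all add: axis_def Q5_coords_def \<Theta>_axis[unfolded axis_def])
      \<comment> \<open>Along an angle the coordinate \<open>s\<close> is constant, so only the
        phase of \<open>e_angular\<close> varies.\<close>
      have eq: "?w i (x + \<tau> *\<^sub>R axis i 1) *\<^sub>R frechet_derivative \<phi> (at (x + \<tau> *\<^sub>R axis i 1)) (axis i 1)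
          = (?w i x * ?S x * \<kappa> i) *\<^sub>R e_angular (\<Theta> x + \<tau> * \<kappa> i)" for \<tau>
        using False by (simp only: frechet_phi[OF y(2)] w[OF y(2)] w[OF x] y(1,3) \<Theta>_axis) (simp add: axis_def)
      have "((\<lambda>\<tau>. \<Theta> x + \<tau> * \<kappa> i) has_derivative (\<lambda>\<tau>. \<tau> * \<kappa> i)) (at 0)"
        by (auto intro!: derivative_eq_intros)
      from has_derivative_scaleR_right[OF e_angular_has_derivative[OF this], of "?w i x * ?S x * \<kappa> i"]
      show ?thesis
        unfolding eq has_vector_derivative_def Z_def using False
        by (simp add: power2_eq_square mult_ac)
    next
      case True
      have line: "((\<lambda>\<tau>. x + \<tau> *\<^sub>R axis 5 1) has_derivative (\<lambda>\<tau>. \<tau> *\<^sub>R axis 5 1)) (at 0)"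
        by (auto intro!: derivative_eq_intros)
      have f: "((\<lambda>y. (?K / 2 * ?S y) *\<^sub>R e_polar y) has_derivative
          (\<lambda>v. (?K / 2 * ?S x) *\<^sub>R (- (\<alpha>' (x$5) * v$5) *\<^sub>R \<phi> x + (?C x * \<Theta> v) *\<^sub>R e_angular (\<Theta> x))
            + (?K / 2 * (\<alpha>' (x$5) * v$5 * ?C x)) *\<^sub>R e_polar x)) (at (x + 0 *\<^sub>R axis 5 1))"
        unfolding scaleR_zero_left add_0_right
        by (intro has_derivative_scaleR has_derivative_mult_right has_derivative_sin
            \<alpha>_has_derivative[OF x] e_polar_has_derivative[OF x])
      have \<Theta>5: "\<Theta> (\<tau> *\<^sub>R axis 5 1) = 0" for \<tau>
        using linear_cmul[OF bounded_linear.linear[OF bounded_linear_\<Theta>]] by (simp add: \<Theta>_axis)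
      have axis5: "(axis 5 1 :: real^5) $ 5 = 1" by (simp add: axis_def)
      have "((\<lambda>\<tau>. (?K / 2 * ?S (x + \<tau> *\<^sub>R axis 5 1)) *\<^sub>R e_polar (x + \<tau> *\<^sub>R axis 5 1))
          has_vector_derivative Z 5 x) (at 0)"
        unfolding has_vector_derivative_def
        by (rule has_derivative_eq_rhs[OF diff_chain_at[OF line f, unfolded o_def]])
          (simp add: Z_def \<Theta>5 axis5 fun_eq_iff algebra_simps)
      \<comment> \<open>The simplified flux is known to equal the original one inside
        \<open>Q5_coords\<close>, so its derivative is carried over on an open set of parameters
        around 0.\<close>
      moreover have "open {\<tau>. x + \<tau> *\<^sub>R axis 5 1 \<in> Q5_coords}"
        using open_vimage[OF open_Q5_coords, of "\<lambda>\<tau>. x + \<tau> *\<^sub>R axis 5 1"]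
        by (simp add: vimage_def continuous_intros)
      ultimately have "((\<lambda>\<tau>. ?w 5 (x + \<tau> *\<^sub>R axis 5 1) *\<^sub>R
          frechet_derivative \<phi> (at (x + \<tau> *\<^sub>R axis 5 1)) (axis 5 1)) has_vector_derivative Z 5 x) (at 0)"
      proof (rule has_vector_derivative_transform_within_open)
        show "0 \<in> {\<tau>. x + \<tau> *\<^sub>R axis 5 1 \<in> Q5_coords}" using x by simp
        fix \<tau> assume "\<tau> \<in> {\<tau>. x + \<tau> *\<^sub>R axis 5 1 \<in> Q5_coords}"
        then have y: "x + \<tau> *\<^sub>R axis 5 1 \<in> Q5_coords" by simp
        have "frechet_derivative \<phi> (at (x + \<tau> *\<^sub>R axis 5 1)) (axis 5 1)
            = \<alpha>' ((x + \<tau> *\<^sub>R axis 5 1) $ 5) *\<^sub>R e_polar (x + \<tau> *\<^sub>R axis 5 1)"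
          unfolding frechet_phi[OF y] by (simp add: \<Theta>_axis axis5)
        then show "(?K / 2 * ?S (x + \<tau> *\<^sub>R axis 5 1)) *\<^sub>R e_polar (x + \<tau> *\<^sub>R axis 5 1)
            = ?w 5 (x + \<tau> *\<^sub>R axis 5 1) *\<^sub>R frechet_derivative \<phi> (at (x + \<tau> *\<^sub>R axis 5 1)) (axis 5 1)"
          by (simp only: scaleR_scaleR w5[OF y])
      qed
      then show ?thesis by (simp only: True)
    qed
    show "(\<Sum>i\<in>UNIV. Z i x) = - (?K * \<alpha>' (x$5) * ?S x) *\<^sub>R \<phi> x"
    proof -
      have "(\<Sum>i\<in>UNIV. ?w i x * ?S x * (\<kappa> i)\<^sup>2)
          = ?K * h (x$5) * sin (4 * x$5) / 8 * ?S x * (\<Sum>i\<in>UNIV. (\<kappa> i)\<^sup>2 / gd (x$5) i)"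
        unfolding w[OF x] by (simp add: sum_distrib_left mult_ac)
      also have "\<dots> = ?K / 2 * \<alpha>' (x$5)"
        unfolding sum_\<kappa>_sq_over_gd[OF s] \<alpha>'_def
        using trig_pos(7)[OF s] by (simp add: power2_eq_square field_simps)
      finally have "(\<Sum>i\<in>UNIV. Z i x) = - (?K / 2 * \<alpha>' (x$5)) *\<^sub>R e_radial (\<Theta> x)
          + (?K / 2 * \<alpha>' (x$5)) *\<^sub>R (?C x *\<^sub>R e_polar x - ?S x *\<^sub>R \<phi> x)"
        unfolding Z_def sum.distrib by (simp add: scaleR_sum_left[symmetric] sum_negf)
      also have "\<dots> = (?K / 2 * \<alpha>' (x$5)) *\<^sub>R ((?C x *\<^sub>R e_polar x - ?S x *\<^sub>R \<phi> x) - e_radial (\<Theta> x))"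
        by (simp add: scaleR_right_diff_distrib)
      also have "(?C x *\<^sub>R e_polar x - ?S x *\<^sub>R \<phi> x) - e_radial (\<Theta> x) = (- 2 * ?S x) *\<^sub>R \<phi> x"
      proof -
        have "(c - b) - (b + c) = (- 2) *\<^sub>R b" for b c :: "complex \<times> real"
          by (simp add: scaleR_2)
        then show ?thesis unfolding e_radial_eq by simp
      qed
      finally show ?thesis by (simp add: mult_ac)
    qed
  qed simp_all
qed

section \<open>Continuous extension to the closure\<close>

lemma continuous_on_\<alpha>: "continuous_on {0..pi/4} \<alpha>"
proof (rule continuous_on_IccI)
  show "\<alpha> \<midarrow>s\<rightarrow> \<alpha> s" if "0 < s" "s < pi/4" for s
    using DERIV_isCont[OF \<alpha>_deriv[of s]] that by (simp add: isCont_def)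
qed (use \<alpha>_lim0 \<alpha>_lim1 in \<open>simp_all add: \<alpha>_0 \<alpha>_1\<close>)

lemma cis_eq_cis_iff: "cis a = cis b \<longleftrightarrow> (\<exists>n::int. a = b + 2 * pi * n)"
  using sin_cos_eq_iff[of a b] by (auto simp: complex_eq_iff)

text \<open>The modulus of the first component determines \<open>s\<close>. In the open interval all
  angles are then determined modulo full turns, which the integer phase ignores. At the ends a
  circle collapses, but there \<open>sin \<alpha>\<close> is 0 and the phase drops out of the
  map.\<close>

lemma phi_eq_if_Q5_param_eq:
  assumes "0 \<le> x$5" "x$5 \<le> pi/4" "0 \<le> y$5" "y$5 \<le> pi/4"
    and eq: "Q5_param a1 a2 a3 a4 x = Q5_param a1 a2 a3 a4 y"
  shows "\<phi> x = \<phi> y"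
proof -
  have sin_nonneg: "sin (x$5) \<ge> 0" "sin (y$5) \<ge> 0"
    using assms by (auto intro!: sin_ge_zero)
  have "norm (fst (Q5_param a1 a2 a3 a4 x)) = norm (fst (Q5_param a1 a2 a3 a4 y))"
    by (simp only: eq)
  then have "sin (x$5) = sin (y$5)"
    using a_pos sin_nonneg by (simp add: Q5_param_def norm_mult)
  then have s: "y$5 = x$5"
    using assms sin_inj_pi[of "x$5" "y$5"] by simp
  show ?thesis
  proof (cases "x$5 \<in> {0<..<pi/4}")
    case False
    then have "x$5 = 0 \<or> x$5 = pi/4" using assms by auto
    then have "\<alpha> (x$5) = 0 \<or> \<alpha> (x$5) = pi" using \<alpha>_0 \<alpha>_1 by metis
    then have "sin (\<alpha> (x$5)) = 0" by auto
    then show ?thesis by (simp add: phi_eq s)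
  next
    case True
    note pos = trig_pos[OF True]
    have "cis (x$1) = cis (y$1)" "cis (x$2) = cis (y$2)" "cis (x$3) = cis (y$3)" "cis (x$4) = cis (y$4)"
      using eq pos a_pos by (simp_all add: Q5_param_def s cis_conv_exp)
    then obtain n1 n2 n3 n4 :: int where "x$1 = y$1 + 2 * pi * n1" "x$2 = y$2 + 2 * pi * n2"
      "x$3 = y$3 + 2 * pi * n3" "x$4 = y$4 + 2 * pi * n4"
      unfolding cis_eq_cis_iff by blast
    then have "\<Theta> x = \<Theta> y + 2 * pi * of_int (k1 * n1 + k2 * n2 + k3 * n3 + k4 * n4)"
      by (simp add: \<Theta>_def algebra_simps)
    then have "cis (\<Theta> x) = cis (\<Theta> y)" unfolding cis_eq_cis_iff by blast
    then show ?thesis by (simp add: phi_eq e_radial_def s)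
  qed
qed

text \<open>Points of \<open>Q5_coords\<close> carry unrestricted angles; subtracting whole turns
  moves them into the compact band without changing the parametrised point.\<close>

lemma Q5_param_reduce_angles:
  obtains y where "Q5_param a1 a2 a3 a4 y = Q5_param a1 a2 a3 a4 x" "y$5 = x$5"
    "\<forall>i. i \<noteq> 5 \<longrightarrow> 0 \<le> y$i \<and> y$i < 2*pi"
proof -
  define y :: "real^5" where
    "y = (\<chi> i. if i = 5 then x$5 else x$i + 2 * pi * of_int (- \<lfloor>x$i / (2*pi)\<rfloor>))"
  have cis: "cis (y$i) = cis (x$i)" if "i \<noteq> 5" for i
    unfolding cis_eq_cis_iff y_def using that by (simp only: vec_lambda_beta if_False) blast
  show thesis
  proof
    show "y$5 = x$5" by (simp add: y_def)
    then show "Q5_param a1 a2 a3 a4 y = Q5_param a1 a2 a3 a4 x"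
      by (simp add: Q5_param_def cis_conv_exp[symmetric] cis)
    have "0 \<le> y$i \<and> y$i < 2*pi" if "i \<noteq> 5" for i
      using that floor_divide_lower[of "2*pi" "x$i"] floor_divide_upper[of "2*pi" "x$i"]
      by (simp add: y_def algebra_simps)
    then show "\<forall>i. i \<noteq> 5 \<longrightarrow> 0 \<le> y$i \<and> y$i < 2*pi" by blast
  qed
qed

lemma continuous_extension_phi:
  "\<exists>F. continuous_on (Q5_star a1 a2 a3 a4) F \<and> F ` Q5_star a1 a2 a3 a4 \<subseteq> sphere 0 1 \<and>
    (\<forall>x\<in>Q5_coords. F (Q5_param a1 a2 a3 a4 x) = \<phi> x)"
proof -
  let ?p = "Q5_param a1 a2 a3 a4" and ?T = "torus_band 0 (pi/4)"
  \<comment> \<open>Any preimage serves, since the map is constant on fibres. The band contains both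
    0 and \<open>2 * pi\<close> for each angle, which makes it compact, unlike the half-open box in
    \<open>Q5_star\<close>.\<close>
  define F where "F z = \<phi> (inv_into ?T ?p z)" for z
  have F: "F (?p x) = \<phi> x" if "x \<in> ?T" for x
  proof -
    have "inv_into ?T ?p (?p x) \<in> ?T" "?p (inv_into ?T ?p (?p x)) = ?p x"
      using that by (auto intro: inv_into_into f_inv_into_f)
    then show ?thesis
      unfolding F_def using that by (intro phi_eq_if_Q5_param_eq) (auto simp: torus_band_def)
  qed
  have \<alpha>: "continuous_on ?T (\<lambda>x. \<alpha> (x$5))"
    by (rule continuous_on_compose2[OF continuous_on_\<alpha>])
      (auto intro!: continuous_intros simp: torus_band_def)
  have "continuous_on ?T \<phi>"
    unfolding phi_eq
    by (intro continuous_intros continuous_on_e_radial \<alpha> linear_continuous_on[OF bounded_linear_\<Theta>])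
  moreover have "continuous_on ?T ?p"
    unfolding Q5_param_def by (intro continuous_intros)
  moreover have "compact ?T" by (simp add: torus_band_eq_cbox)
  ultimately have "continuous_on (?p ` ?T) F"
    using F by (intro continuous_on_compact_quotient)
  moreover have "Q5_star a1 a2 a3 a4 \<subseteq> ?p ` ?T"
    unfolding Q5_star_def torus_band_def by (intro image_mono) (auto simp: less_imp_le)
  moreover have "F z \<in> sphere 0 1" for z
    by (simp add: F_def norm_eq_1)
  moreover have "F (?p x) = \<phi> x" if "x \<in> Q5_coords" for x
  proof -
    obtain y where y: "?p y = ?p x" "y$5 = x$5" "\<forall>i. i \<noteq> 5 \<longrightarrow> 0 \<le> y$i \<and> y$i < 2*pi"
      by (rule Q5_param_reduce_angles[of x])
    then have "y \<in> ?T" using that by (auto simp: torus_band_def Q5_coords_def less_imp_le)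
    then have "F (?p x) = \<phi> y" using F y(1) by metis
    also have "\<phi> y = \<phi> x"
      using y that by (intro phi_eq_if_Q5_param_eq) (auto simp: Q5_coords_def)
    finally show ?thesis .
  qed
  ultimately show ?thesis
    by (intro exI[of _ F] conjI) (auto intro: continuous_on_subset)
qed

end

theorem theorem2p2:
  fixes k1 k2 k3 k4 :: int and a1 a2 a3 a4 :: real
  assumes "a1 > 0" "a2 > 0" "a3 > 0" "a4 > 0"
    and "a1 = \<bar>of_int k1\<bar>" "a2 = \<bar>of_int k2\<bar>" "a3 = \<bar>of_int k3\<bar>" "a4 = \<bar>of_int k4\<bar>"
  shows "\<exists>\<alpha> :: real \<Rightarrow> real.
    smooth_on {0<..<pi/4} \<alpha> \<and>
    \<alpha> ` {0<..<pi/4} \<subseteq> {0<..<pi} \<and>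
    (\<alpha> \<longlongrightarrow> 0) (at_right 0) \<and>
    (\<alpha> \<longlongrightarrow> pi) (at_left (pi/4)) \<and>
    harmonic_morphism_sphere (Q5_metric a1 a2 a3 a4) (phi_map k1 k2 k3 k4 \<alpha>) \<and>
    (\<exists>F :: complex \<times> complex \<times> complex \<times> complex \<Rightarrow> complex \<times> real.
       continuous_on (Q5_star a1 a2 a3 a4) F \<and>
       F ` Q5_star a1 a2 a3 a4 \<subseteq> sphere 0 1 \<and>
       (\<forall>x\<in>Q5_coords. F (Q5_param a1 a2 a3 a4 x) = phi_map k1 k2 k3 k4 \<alpha> x))"
proof -
  interpret Q5_setting k1 k2 k3 k4 a1 a2 a3 a4
    by unfold_locales (use assms in auto)
  obtain \<alpha> where \<alpha>:
    "\<And>s. s \<in> {0<..<pi/4} \<Longrightarrow> (\<alpha> has_real_derivative 4 * h s * sin (\<alpha> s) / sin (4 * s)) (at s)"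
    "smooth_on {0<..<pi/4} \<alpha>"
    "\<And>s. s \<in> {0<..<pi/4} \<Longrightarrow> \<alpha> s \<in> {0<..<pi}"
    "(\<alpha> \<longlongrightarrow> 0) (at_right 0)" "(\<alpha> \<longlongrightarrow> pi) (at_left (pi/4))"
    "\<alpha> 0 = 0" "\<alpha> (pi/4) = pi"
    using alpha_exists by blast
  interpret Q5_profile k1 k2 k3 k4 a1 a2 a3 a4 \<alpha>
    by unfold_locales (fact \<alpha>)+
  have "harmonic_morphism_sphere (Q5_metric a1 a2 a3 a4) (phi_map k1 k2 k3 k4 \<alpha>)"
    unfolding harmonic_morphism_sphere_def
    using harmonic_phi horizontally_weakly_conformal_phi by blast
  moreover have "\<alpha> ` {0<..<pi/4} \<subseteq> {0<..<pi}" using \<alpha>(3) by blast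
  ultimately show ?thesis
    using \<alpha>(2,4,5) continuous_extension_phi by blast
qed

end
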